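(* Let $t=(\mathcal{G},\sigma,\Omega)$ be a symplectic symmetric triple such that $\mathcal{G}$ is neither solvable nor semisimple, with canonical decomposition $\mathcal{G}=\mathcal{K}\oplus\mathcal{P}$. Let $\mathcal{R}$ be the radical of $\mathcal{G}$ and $\mathcal{P}_{\mathcal{R}}=\mathcal{P}\cap\mathcal{R}$. Then $$2\leq\dim\mathcal{P}_{\mathcal{R}}\leq\dim\mathcal{P}-2.$$
   Context: A symplectic symmetric triple is a triple $t=(\mathcal{G},\sigma,\Omega)$ where: (i) $\mathcal{G}$ is a finite-dimensional real Lie algebra; (ii) $\sigma$ is an involutive automorphism of $\mathcal{G}$ such that, writing $\mathcal{G}=\mathcal{K}\oplus\mathcal{P}$ with $\sigma=\mathrm{id}_{\mathcal{K}}\oplus(-\mathrm{id}_{\mathcal{P}})$ (canonical decomposition), one has $[\mathcal{P},\mathcal{P}]=\mathcal{K}$ and $\mathcal{K}$ acts faithfully on $\mathcal{P}$; (iii) $\Omega$ is a $\mathcal{K}$-invariant symplectic form on $\mathcal{P}$. *)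

theory Defs
  imports "HOL-Analysis.Analysis"
begin

section \<open>Finite-dimensional real Lie algebras\<close>

text \<open>
  A Lie algebra is a whole type of class \<open>real_vector\<close> together with a bracket;
  finite-dimensionality is an explicit hypothesis, so the zero Lie algebra is included.
\<close>

definition fin_dim_lie_algebra :: "('a::real_vector \<Rightarrow> 'a \<Rightarrow> 'a) \<Rightarrow> bool" where
  "fin_dim_lie_algebra br \<longleftrightarrow>
     (\<exists>B::'a set. finite B \<and> span B = UNIV) \<and>
     bilinear br \<and>
     (\<forall>x. br x x = 0) \<and>
     (\<forall>x y z. br x (br y z) + br y (br z x) + br z (br x y) = 0)"

definition bracket_span :: "('a::real_vector \<Rightarrow> 'a \<Rightarrow> 'a) \<Rightarrow> 'a set \<Rightarrow> 'a set \<Rightarrow> 'a set" where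
  "bracket_span br A B = span {br a b |a b. a \<in> A \<and> b \<in> B}"

definition lie_ideal :: "('a::real_vector \<Rightarrow> 'a \<Rightarrow> 'a) \<Rightarrow> 'a set \<Rightarrow> bool" where
  "lie_ideal br I \<longleftrightarrow> subspace I \<and> (\<forall>x. \<forall>y\<in>I. br x y \<in> I)"

primrec derived_series :: "('a::real_vector \<Rightarrow> 'a \<Rightarrow> 'a) \<Rightarrow> 'a set \<Rightarrow> nat \<Rightarrow> 'a set" where
  "derived_series br A 0 = A"
| "derived_series br A (Suc n) = bracket_span br (derived_series br A n) (derived_series br A n)"

text \<open>Meant for subalgebras \<open>A\<close>; the Lie algebra itself is \<open>A = UNIV\<close>.\<close>

definition lie_solvable :: "('a::real_vector \<Rightarrow> 'a \<Rightarrow> 'a) \<Rightarrow> 'a set \<Rightarrow> bool" where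
  "lie_solvable br A \<longleftrightarrow> (\<exists>n. derived_series br A n = {0})"

text \<open>
  The radical is the sum of all solvable ideals; \<open>lie_radical_greatest\<close> below shows
  that it is the greatest solvable ideal.
\<close>

definition lie_radical :: "('a::real_vector \<Rightarrow> 'a \<Rightarrow> 'a) \<Rightarrow> 'a set" where
  "lie_radical br = span (\<Union>{I. lie_ideal br I \<and> lie_solvable br I})"

definition lie_semisimple :: "('a::real_vector \<Rightarrow> 'a \<Rightarrow> 'a) \<Rightarrow> bool" where
  "lie_semisimple br \<longleftrightarrow> lie_radical br = {0}"


section \<open>Symplectic symmetric triples\<close>

definition involutive_automorphism ::
    "('a::real_vector \<Rightarrow> 'a \<Rightarrow> 'a) \<Rightarrow> ('a \<Rightarrow> 'a) \<Rightarrow> bool" where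
  "involutive_automorphism br \<sigma> \<longleftrightarrow>
     linear \<sigma> \<and> (\<forall>x y. \<sigma> (br x y) = br (\<sigma> x) (\<sigma> y)) \<and> \<sigma> \<circ> \<sigma> = id"

text \<open>The two summands of the canonical decomposition: the eigenspaces of \<open>\<sigma>\<close> for 1 and -1.\<close>

definition K_part :: "('a::real_vector \<Rightarrow> 'a) \<Rightarrow> 'a set" where
  "K_part \<sigma> = {x. \<sigma> x = x}"

definition P_part :: "('a::real_vector \<Rightarrow> 'a) \<Rightarrow> 'a set" where
  "P_part \<sigma> = {x. \<sigma> x = - x}"

text \<open>Only the values of \<open>\<Omega>\<close> on \<open>P \<times> P\<close> matter.\<close>

definition symplectic_form_on :: "'a::real_vector set \<Rightarrow> ('a \<Rightarrow> 'a \<Rightarrow> real) \<Rightarrow> bool" where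
  "symplectic_form_on P \<Omega> \<longleftrightarrow>
     (\<forall>x\<in>P. \<forall>y\<in>P. \<forall>z\<in>P. \<Omega> (x + y) z = \<Omega> x z + \<Omega> y z \<and> \<Omega> z (x + y) = \<Omega> z x + \<Omega> z y) \<and>
     (\<forall>c. \<forall>x\<in>P. \<forall>y\<in>P. \<Omega> (c *\<^sub>R x) y = c * \<Omega> x y \<and> \<Omega> x (c *\<^sub>R y) = c * \<Omega> x y) \<and>
     (\<forall>x\<in>P. \<Omega> x x = 0) \<and>
     (\<forall>x\<in>P. (\<forall>y\<in>P. \<Omega> x y = 0) \<longrightarrow> x = 0)"

definition symplectic_symmetric_triple ::
    "('a::real_vector \<Rightarrow> 'a \<Rightarrow> 'a) \<Rightarrow> ('a \<Rightarrow> 'a) \<Rightarrow> ('a \<Rightarrow> 'a \<Rightarrow> real) \<Rightarrow> bool" where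
  "symplectic_symmetric_triple br \<sigma> \<Omega> \<longleftrightarrow>
     fin_dim_lie_algebra br \<and>
     involutive_automorphism br \<sigma> \<and>
     bracket_span br (P_part \<sigma>) (P_part \<sigma>) = K_part \<sigma> \<and>
     (\<forall>k\<in>K_part \<sigma>. (\<forall>p\<in>P_part \<sigma>. br k p = 0) \<longrightarrow> k = 0) \<and>
     symplectic_form_on (P_part \<sigma>) \<Omega> \<and>
     (\<forall>k\<in>K_part \<sigma>. \<forall>x\<in>P_part \<sigma>. \<forall>y\<in>P_part \<sigma>. \<Omega> (br k x) y + \<Omega> x (br k y) = 0)"


section \<open>The radical is the greatest solvable ideal\<close>

lemma derived_series_subspace: "subspace A \<Longrightarrow> subspace (derived_series br A n)"
  by (cases n) (auto simp: bracket_span_def)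

lemma bracket_span_mono: "A \<subseteq> A' \<Longrightarrow> B \<subseteq> B' \<Longrightarrow> bracket_span br A B \<subseteq> bracket_span br A' B'"
  unfolding bracket_span_def by (rule span_mono) blast

lemma derived_series_mono: "A \<subseteq> B \<Longrightarrow> derived_series br A n \<subseteq> derived_series br B n"
  by (induction n) (auto intro: bracket_span_mono[THEN subsetD])

lemma derived_series_add:
  "derived_series br A (m + n) = derived_series br (derived_series br A m) n"
  by (induction n) auto

lemma derived_series_sum_subset:
  assumes "bilinear br" and anti: "\<And>x y. br x y = - br y x"
    and I: "subspace I" and J: "lie_ideal br J"
  shows "derived_series br {x + y |x y. x \<in> I \<and> y \<in> J} n
          \<subseteq> {x + y |x y. x \<in> derived_series br I n \<and> y \<in> J}"
proof (induction n)
  case 0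
  then show ?case by simp
next
  case (Suc n)
  let ?D = "derived_series br I n" and ?D' = "derived_series br I (Suc n)"
  let ?S = "{x + y |x y. x \<in> ?D' \<and> y \<in> J}"
  have sJ: "subspace J" and J1: "\<And>x y. y \<in> J \<Longrightarrow> br x y \<in> J"
    using J by (auto simp: lie_ideal_def)
  have J2: "br y x \<in> J" if "y \<in> J" for x y
    using J1[OF that, of x] anti[of y x] sJ by (simp add: subspace_neg)
  have sS: "subspace ?S"
    by (intro subspace_sums sJ derived_series_subspace I)
  have "br a b \<in> ?S"
    if "a \<in> {x + y |x y. x \<in> ?D \<and> y \<in> J}" "b \<in> {x + y |x y. x \<in> ?D \<and> y \<in> J}" for a b
  proof -
    obtain x y u v where *: "a = x + y" "b = u + v" "x \<in> ?D" "u \<in> ?D" "y \<in> J" "v \<in> J"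
      using \<open>a \<in> _\<close> \<open>b \<in> _\<close> by blast
    have "br a b = br x u + (br x v + (br y u + br y v))"
      using assms(1) by (simp add: * bilinear_ladd bilinear_radd)
    moreover have "br x u \<in> ?D'"
      using * by (auto simp: bracket_span_def intro!: span_base)
    moreover have "br x v + (br y u + br y v) \<in> J"
      using * J1 J2 sJ by (simp add: subspace_add)
    ultimately show ?thesis by blast
  qed
  then have "bracket_span br {x + y |x y. x \<in> ?D \<and> y \<in> J} {x + y |x y. x \<in> ?D \<and> y \<in> J} \<subseteq> ?S"
    unfolding bracket_span_def by (intro span_minimal sS) blast
  then show ?case
    using bracket_span_mono[OF Suc Suc, of br] by (simp only: derived_series.simps)
qed

lemma solvable_ideal_sum:
  assumes L: "fin_dim_lie_algebra br"
    and I: "lie_ideal br I" "lie_solvable br I" and J: "lie_ideal br J" "lie_solvable br J"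
  shows "lie_ideal br {x + y |x y. x \<in> I \<and> y \<in> J}"
    and "lie_solvable br {x + y |x y. x \<in> I \<and> y \<in> J}"
proof -
  let ?S = "{x + y |x y. x \<in> I \<and> y \<in> J}"
  have bil: "bilinear br" and alt: "\<And>x. br x x = 0"
    using L by (auto simp: fin_dim_lie_algebra_def)
  have anti: "br x y = - br y x" for x y
    using alt[of "x + y"] alt[of x] alt[of y]
    by (simp add: bilinear_ladd[OF bil] bilinear_radd[OF bil] eq_neg_iff_add_eq_0 add.commute)
  have sI: "subspace I" and sJ: "subspace J"
    using I J by (auto simp: lie_ideal_def)
  then have sS: "subspace ?S" by (rule subspace_sums)
  show "lie_ideal br ?S"
    unfolding lie_ideal_def
  proof (intro conjI sS allI ballI)
    fix a b assume "b \<in> ?S"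
    then obtain x y where "b = x + y" "x \<in> I" "y \<in> J" by blast
    moreover from this have "br a x \<in> I" "br a y \<in> J"
      using I J by (auto simp: lie_ideal_def)
    ultimately show "br a b \<in> ?S"
      by (auto simp: bilinear_radd[OF bil])
  qed
  obtain m n where m: "derived_series br I m = {0}" and n: "derived_series br J n = {0}"
    using I J by (auto simp: lie_solvable_def)
  have "derived_series br ?S m \<subseteq> J"
    using derived_series_sum_subset[OF bil anti sI J(1), of m] m by auto
  then have "derived_series br ?S (m + n) \<subseteq> {0}"
    using derived_series_mono[of "derived_series br ?S m" J br n]
    by (simp add: derived_series_add n)
  moreover have "0 \<in> derived_series br ?S (m + n)"
    by (intro subspace_0 derived_series_subspace sS)
  ultimately show "lie_solvable br ?S"
    unfolding lie_solvable_def by blast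
qed

theorem lie_radical_greatest:
  assumes L: "fin_dim_lie_algebra br"
  shows "lie_ideal br (lie_radical br)" and "lie_solvable br (lie_radical br)"
    and "lie_ideal br I \<Longrightarrow> lie_solvable br I \<Longrightarrow> I \<subseteq> lie_radical br"
proof -
  let ?P = "\<lambda>I. lie_ideal br I \<and> lie_solvable br I"
  obtain B :: "'a set" where B: "finite B" "span B = UNIV" and bil: "bilinear br"
    using L by (auto simp: fin_dim_lie_algebra_def)
  have bound: "dim A \<le> card B" for A :: "'a set"
    using B by (intro dim_le_card) auto
  have "?P {0}"
    using bil by (auto simp: lie_ideal_def lie_solvable_def bilinear_rzero intro: exI[of _ 0])
  then obtain R where R: "?P R" and max: "\<And>I. ?P I \<Longrightarrow> dim I \<le> dim R"
    using ex_has_greatest_nat[of ?P "{0}" dim "Suc (card B)"] bound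
    by (auto simp: less_Suc_eq_le)
  have sR: "subspace R" using R by (simp add: lie_ideal_def)
  have sub: "I \<subseteq> R" if "?P I" for I
  proof
    fix x assume "x \<in> I"
    let ?S = "{x + y |x y. x \<in> R \<and> y \<in> I}"
    have S: "?P ?S" using solvable_ideal_sum[OF L] R that by blast
    then have sS: "subspace ?S" by (simp add: lie_ideal_def)
    have "0 \<in> R" "0 \<in> I" using R that by (auto simp: lie_ideal_def subspace_0)
    have "R \<subseteq> ?S" using \<open>0 \<in> I\<close> by force
    have "x \<in> ?S" using \<open>0 \<in> R\<close> \<open>x \<in> I\<close> by force
    obtain C where C: "C \<subseteq> R" "independent C" "R \<subseteq> span C" "card C = dim R"
      using basis_exists by blast
    have fin: "finite C"
      using independent_span_bound[OF B(1) C(2)] B(2) by simp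
    show "x \<in> R"
    proof (rule ccontr)
      assume "x \<notin> R"
      then have x: "x \<notin> span C" using span_minimal[OF C(1) sR] by blast
      then have ind: "independent (insert x C)" using C(2) by (simp add: independent_insert)
      have "x \<notin> C" using x by (auto intro: span_base)
      obtain E where E: "E \<subseteq> ?S" "independent E" "?S \<subseteq> span E" "card E = dim ?S"
        using basis_exists by blast
      have "finite E"
        using independent_span_bound[OF B(1) E(2)] B(2) by simp
      moreover have "insert x C \<subseteq> span E"
        using C(1) \<open>R \<subseteq> ?S\<close> \<open>x \<in> ?S\<close> E(3) by blast
      ultimately have "card (insert x C) \<le> card E"
        using independent_span_bound ind by blast
      then show False
        using max[OF S] E(4) C(4) fin \<open>x \<notin> C\<close> by simp
    qed
  qed
  have "\<Union>{I. ?P I} = R" using sub R by blast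
  then have rad: "lie_radical br = R"
    using sR by (simp add: lie_radical_def span_eq_iff)
  show "lie_ideal br (lie_radical br)" "lie_solvable br (lie_radical br)"
    using R by (auto simp: rad)
  show "lie_ideal br I \<Longrightarrow> lie_solvable br I \<Longrightarrow> I \<subseteq> lie_radical br"
    using sub by (auto simp: rad)
qed

end

theory Submission
  imports Defs "HOL-Computational_Algebra.Fundamental_Theorem_Algebra"
begin

text \<open>
  Write \<open>G = K \<oplus> P\<close> for the Lie algebra, \<open>R\<close> for its radical and \<open>P\<^sub>R = P \<inter> R\<close>. The radical is
  stable under the involution, so it splits as \<open>(K \<inter> R) \<oplus> P\<^sub>R\<close>.

  The upper bound comes from \<open>[P,P] = K\<close>. If \<open>P\<close> were spanned by \<open>P\<^sub>R\<close> and one more vector, then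
  \<open>K = [P,P]\<close> would lie in \<open>R\<close>, hence \<open>[G,G]\<close> would lie in \<open>R\<close> and \<open>G\<close> would be solvable
  (\<open>solvable_if_P_spanned_mod_radical_by_one\<close>).

  For the lower bound, \<open>P\<^sub>R = 0\<close> makes \<open>R = K \<inter> R\<close> act trivially on \<open>P\<close>, so \<open>R = 0\<close> by faithfulness
  (\<open>radical_zero_if_P_radical_zero\<close>).
  The substance is that \<open>P\<^sub>R\<close> is not a line \<open>\<real>v\<close> (\<open>P_radical_not_line\<close>). Every \<open>\<kappa> \<in> K \<inter> R\<close> maps \<open>P\<close>
  into that line, and invariance of \<open>\<Omega>\<close> forces \<open>\<kappa> y = c \<cdot> \<Omega>(v,y) v\<close>. The Jacobi identity then shows
  that the character by which \<open>K = [P,P]\<close> acts on \<open>v\<close> vanishes. Consequently \<open>v\<close> is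
  \<open>\<Omega>\<close>-orthogonal to \<open>[K,P]\<close> and Killing-orthogonal to \<open>P\<close>. If \<open>G/R\<close> is known to be perfect, then
  \<open>P = [K,P] + P\<^sub>R\<close> and \<open>v\<close> is \<open>\<Omega>\<close>-orthogonal to all of \<open>P\<close>, which is absurd.

  The same conclusion is reached here without forming the quotient, from the fact that the
  Killing-orthogonal of \<open>[G,G]\<close> lies in \<open>R\<close> (\<open>killing_orthogonal_derived_in_radical\<close>). The kernel of
  the Killing form on \<open>P\<close> lies in \<open>P\<^sub>R = \<real>v\<close>, where the functional \<open>\<Omega>(v,-)\<close> vanishes; hence this
  functional is represented by some \<open>z \<in> P\<close>. As \<open>\<Omega>(v,-)\<close> kills \<open>[K,P]\<close>, the vector \<open>z\<close> is
  Killing-orthogonal to \<open>[G,G]\<close>, so it is a multiple of \<open>v\<close>. But \<open>v\<close> is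
  Killing-orthogonal to \<open>P\<close>, so \<open>\<Omega>(v,-)\<close> is zero, contrary to nondegeneracy.

  The orthogonality fact is Cartan's criterion (\<open>cartan_solvability\<close>), and most of the text is devoted
  to it. An ideal \<open>J\<close> that is Killing-orthogonal to \<open>[G,G]\<close> is shown to be solvable by applying
  Engel's theorem to \<open>[J,G]\<close>. The nilpotency of \<open>ad x\<close> for \<open>x \<in> [J,G]\<close> is obtained from the operator
  \<open>Y\<close> that acts on each generalized eigenspace of \<open>ad x\<close> as the complex conjugate of its eigenvalue:
  \<open>Y\<close> is again a real derivation, so \<open>trace (ad x \<circ> Y)\<close> can be computed from the Killing form and
  vanishes, whereas it is also the sum of the \<open>\<bar>l\<bar>\<^sup>2\<close> over the eigenvalues \<open>l\<close> of \<open>ad x\<close>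
  (\<open>conjugate_semisimple_part\<close>, \<open>nonneg_gen_eigenvalues_trace\<close>).
\<close>

section \<open>Generalized eigenspaces\<close>

text \<open>The field of scalars is a parameter because the same facts are needed for complex scalars, acting on
  a complexification, and for real ones.\<close>

locale operator_space = vector_space scale
  for scale :: "'f::field \<Rightarrow> 'v::ab_group_add \<Rightarrow> 'v" (infixr "*\<^sub>s" 75) +
  fixes X :: "'v \<Rightarrow> 'v"
  assumes X_add: "X (u + v) = X u + X v"
    and X_scale: "X (c *\<^sub>s u) = c *\<^sub>s X u"
begin

definition shift :: "'f \<Rightarrow> 'v \<Rightarrow> 'v" where
  "shift l u = X u - l *\<^sub>s u"

definition gen_eigenspace :: "'f \<Rightarrow> 'v set" where
  "gen_eigenspace l = {u. \<exists>n. (shift l ^^ n) u = 0}"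

abbreviation gen_eigenvectors :: "'v set" where
  "gen_eigenvectors \<equiv> \<Union>l. gen_eigenspace l"

lemma X_0 [simp]: "X 0 = 0"
  using X_add[of 0 0] by simp

lemma X_minus: "X (- u) = - X u"
  using X_add[of u "- u"] by (simp add: eq_neg_iff_add_eq_0 add.commute)

lemma X_diff: "X (u - v) = X u - X v"
  using X_add[of u "- v"] by (simp add: X_minus)

lemma shift_add: "shift l (u + v) = shift l u + shift l v"
  by (simp add: shift_def X_add scale_right_distrib)

lemma shift_scale: "shift l (c *\<^sub>s u) = c *\<^sub>s shift l u"
  by (simp add: shift_def X_scale scale_right_diff_distrib scale_left_commute)

lemma shift_0 [simp]: "shift l 0 = 0"
  by (simp add: shift_def)

lemma shift_diff: "shift l (u - v) = shift l u - shift l v"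
  by (simp add: shift_def X_diff scale_right_diff_distrib algebra_simps)

lemma shift_commute: "shift l (shift m u) = shift m (shift l u)"
  by (simp add: shift_def X_diff X_scale scale_right_diff_distrib scale_left_commute)

lemma funpow_shift_0 [simp]: "(shift l ^^ n) 0 = 0"
  by (induction n) auto

lemma funpow_shift_add: "(shift l ^^ n) (u + v) = (shift l ^^ n) u + (shift l ^^ n) v"
  by (induction n) (auto simp: shift_add)

lemma funpow_shift_scale: "(shift l ^^ n) (c *\<^sub>s u) = c *\<^sub>s (shift l ^^ n) u"
  by (induction n) (auto simp: shift_scale)

lemma funpow_shift_commute: "(shift l ^^ n) (shift m u) = shift m ((shift l ^^ n) u)"
  by (induction n) (auto simp: shift_commute)

lemma funpow_shift_mono:
  assumes "(shift l ^^ n) u = 0" "n \<le> m" shows "(shift l ^^ m) u = 0"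
proof -
  have "(shift l ^^ m) u = (shift l ^^ (m - n)) ((shift l ^^ n) u)"
    using assms(2) by (simp flip: funpow_add[THEN fun_cong, unfolded o_apply])
  then show ?thesis using assms(1) by simp
qed

lemma subspace_gen_eigenspace: "subspace (gen_eigenspace l)"
proof (rule subspaceI)
  show "0 \<in> gen_eigenspace l" by (auto simp: gen_eigenspace_def)
next
  fix u v assume "u \<in> gen_eigenspace l" "v \<in> gen_eigenspace l"
  then obtain m n where "(shift l ^^ m) u = 0" "(shift l ^^ n) v = 0"
    by (auto simp: gen_eigenspace_def)
  then have "(shift l ^^ (max m n)) u = 0" "(shift l ^^ (max m n)) v = 0"
    by (auto intro: funpow_shift_mono)
  then have "(shift l ^^ (max m n)) (u + v) = 0" by (simp add: funpow_shift_add)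
  then show "u + v \<in> gen_eigenspace l" by (auto simp: gen_eigenspace_def)
next
  fix c u assume "u \<in> gen_eigenspace l"
  then show "c *\<^sub>s u \<in> gen_eigenspace l"
    by (auto simp: gen_eigenspace_def funpow_shift_scale)
qed

lemma shift_in_gen_eigenspace_iff: "shift l u \<in> gen_eigenspace l \<longleftrightarrow> u \<in> gen_eigenspace l"
proof -
  have "shift l u \<in> gen_eigenspace l \<longleftrightarrow> (\<exists>n. (shift l ^^ Suc n) u = 0)"
    by (simp add: gen_eigenspace_def funpow_swap1)
  also have "\<dots> \<longleftrightarrow> (\<exists>n. (shift l ^^ n) u = 0)"
    by (metis funpow_shift_mono le_SucI order_refl)
  finally show ?thesis by (simp add: gen_eigenspace_def)
qed

lemma shift_gen_eigenspace: "u \<in> gen_eigenspace l \<Longrightarrow> shift m u \<in> gen_eigenspace l"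
  unfolding gen_eigenspace_def mem_Collect_eq by (metis funpow_shift_commute shift_0)

text \<open>On a generalized eigenspace the operator differs from the scalar eigenvalue by a locally
  nilpotent operator, so shifting by any other scalar is invertible there: the inverse is the
  geometric series, summed here by induction on the nilpotency degree.\<close>

lemma shift_surj_on_gen_eigenspace:
  assumes "l \<noteq> m" "w \<in> gen_eigenspace m"
  shows "\<exists>u\<in>gen_eigenspace m. shift l u = w"
proof -
  have "\<exists>u\<in>gen_eigenspace m. shift l u = w" if "(shift m ^^ n) w = 0" for n w
    using that
  proof (induction n arbitrary: w)
    case 0
    then show ?case using subspace_0[OF subspace_gen_eigenspace] by force
  next
    case (Suc n)
    then have "(shift m ^^ n) (shift m w) = 0" by (simp add: funpow_swap1)
    then obtain u where u: "u \<in> gen_eigenspace m" "shift l u = shift m w"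
      using Suc.IH by blast
    have w: "w \<in> gen_eigenspace m" using Suc.prems unfolding gen_eigenspace_def by blast
    have "shift l (w - u) = (m - l) *\<^sub>s w"
      by (simp only: shift_diff u) (simp add: shift_def scale_left_diff_distrib)
    then have "shift l ((1 / (m - l)) *\<^sub>s (w - u)) = w"
      using assms(1) by (simp add: shift_scale)
    moreover have "(1 / (m - l)) *\<^sub>s (w - u) \<in> gen_eigenspace m"
      using u w by (intro subspace_scale subspace_diff subspace_gen_eigenspace)
    ultimately show ?case by blast
  qed
  then show ?thesis using assms(2) by (auto simp: gen_eigenspace_def)
qed

lemma shift_inj_on_gen_eigenspace:
  assumes "l \<noteq> m" "u \<in> gen_eigenspace m" "shift l u = 0"
  shows "u = 0"
proof -
  have "shift m u = (l - m) *\<^sub>s u"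
    using assms(3) by (simp add: shift_def scale_left_diff_distrib)
  then have "(shift m ^^ n) u = (l - m) ^ n *\<^sub>s u" for n
    by (induction n) (auto simp: shift_scale mult.commute)
  then show ?thesis using assms by (auto simp: gen_eigenspace_def)
qed

lemma funpow_shift_inj_on_gen_eigenspace:
  assumes "l \<noteq> m" "u \<in> gen_eigenspace m" "(shift l ^^ n) u = 0"
  shows "u = 0"
  using assms(2,3)
proof (induction n arbitrary: u)
  case (Suc n)
  then have "shift l u = 0"
    using shift_gen_eigenspace[of u m l] by (simp add: funpow_swap1)
  then show ?case using shift_inj_on_gen_eigenspace assms(1) Suc.prems by blast
qed simp

text \<open>Applying the power of \<open>shift a\<close> that annihilates the component at \<open>a\<close> keeps the other components
  in their generalized eigenspaces and is injective there, so induction on the number of components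
  applies.\<close>

lemma gen_eigenspaces_independent:
  assumes "finite A" "\<And>l. c l \<in> gen_eigenspace l" "(\<Sum>l\<in>A. c l) = 0" "m \<in> A"
  shows "c m = 0"
  using assms
proof (induction A arbitrary: c m rule: finite_induct)
  case (insert a A)
  obtain n where n: "(shift a ^^ n) (c a) = 0"
    using insert.prems(1)[of a] by (auto simp: gen_eigenspace_def)
  let ?d = "\<lambda>l. (shift a ^^ n) (c l)"
  have sum: "(shift a ^^ n) (\<Sum>l\<in>B. f l) = (\<Sum>l\<in>B. (shift a ^^ n) (f l))" for B f
    by (induction B rule: infinite_finite_induct) (auto simp: funpow_shift_add)
  have "(\<Sum>l\<in>insert a A. ?d l) = 0"
    using insert.prems(2) by (simp flip: sum)
  then have "(\<Sum>l\<in>A. ?d l) = 0" using insert.hyps n by simp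
  moreover have "?d l \<in> gen_eigenspace l" for l
    using insert.prems(1)[of l] by (induction n) (auto intro: shift_gen_eigenspace)
  ultimately have d: "?d l = 0" if "l \<in> A" for l using insert.IH[of ?d] that by blast
  have c: "c l = 0" if "l \<in> A" for l
    using funpow_shift_inj_on_gen_eigenspace[OF _ insert.prems(1) d[OF that]] insert.hyps that by blast
  have "c a = 0" using insert.prems(2) insert.hyps c by simp
  then show ?case using c insert.prems(3) by blast
qed simp

text \<open>The components of \<open>shift l u\<close> at eigenvalues other than \<open>l\<close> can be lifted along \<open>shift l\<close>.
  After subtracting the lifts from \<open>u\<close> only the component at \<open>l\<close> is left, and its preimages are
  generalized eigenvectors at \<open>l\<close> themselves.\<close>

lemma span_gen_eigenvectors_shift:
  assumes "shift l u \<in> span gen_eigenvectors"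
  shows "u \<in> span gen_eigenvectors"
proof -
  let ?W = "span gen_eigenvectors"
  have "\<exists>w'\<in>?W. w - shift l w' \<in> gen_eigenspace l" if "w \<in> ?W" for w
    using that
  proof (induction rule: span_induct_alt)
    case base
    then show ?case using subspace_0[OF subspace_gen_eigenspace] span_zero by force
  next
    case (step c g w)
    from step obtain w' where w': "w' \<in> ?W" "w - shift l w' \<in> gen_eigenspace l" by blast
    obtain m where m: "g \<in> gen_eigenspace m" using step by blast
    have "\<exists>g'\<in>?W. g - shift l g' \<in> gen_eigenspace l"
    proof (cases "m = l")
      case True
      then show ?thesis using m by (intro bexI[of _ 0]) (auto intro: span_zero)
    next
      case False
      then obtain g' where "g' \<in> gen_eigenspace m" "shift l g' = g"
        using shift_surj_on_gen_eigenspace m by metis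
      then show ?thesis
        using subspace_0[OF subspace_gen_eigenspace] by (intro bexI[of _ g']) (auto intro: span_base)
    qed
    then obtain g' where g': "g' \<in> ?W" "g - shift l g' \<in> gen_eigenspace l" by blast
    have "(c *\<^sub>s g + w) - shift l (c *\<^sub>s g' + w') = c *\<^sub>s (g - shift l g') + (w - shift l w')"
      by (simp add: shift_add shift_scale scale_right_diff_distrib)
    also have "\<dots> \<in> gen_eigenspace l"
      using w' g' by (intro subspace_add subspace_scale subspace_gen_eigenspace)
    finally show ?case
      using w' g' by (intro bexI[of _ "c *\<^sub>s g' + w'"]) (auto intro: span_add span_scale)
  qed
  then obtain w' where w': "w' \<in> ?W" "shift l (u - w') \<in> gen_eigenspace l"
    using assms by (auto simp: shift_diff)
  then have "u - w' \<in> ?W" unfolding shift_in_gen_eigenspace_iff by (blast intro: span_base)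
  then show ?thesis using w' span_add[of "u - w'" _ w'] by simp
qed

text \<open>Horner's scheme rather than a sum over the coefficients: synthetic division then follows by a
  direct induction.\<close>

definition poly_op :: "'f poly \<Rightarrow> 'v \<Rightarrow> 'v" where
  "poly_op p u = fold_coeffs (\<lambda>a w. a *\<^sub>s u + X w) p 0"

lemma poly_op_0 [simp]: "poly_op 0 u = 0"
  by (simp add: poly_op_def)

lemma poly_op_pCons [simp]: "poly_op (pCons a p) u = a *\<^sub>s u + X (poly_op p u)"
  by (cases "p = 0 \<and> a = 0") (auto simp: poly_op_def)

text \<open>Dividing \<open>p\<close> by the linear factor belonging to \<open>l\<close>, read as an identity of operators. Splitting off
  the linear factors of an annihilating polynomial one by one uses only this.\<close>

lemma poly_op_synthetic_div:
  "poly_op p u = poly_op (synthetic_div p l) (shift l u) + poly p l *\<^sub>s u"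
  by (induction p) (simp_all add: X_add X_scale shift_def algebra_simps scale_left_distrib
      scale_right_diff_distrib)

lemma poly_op_Poly: "poly_op (Poly xs) u = (\<Sum>i<length xs. (xs ! i) *\<^sub>s (X ^^ i) u)"
proof (induction xs)
  case (Cons a xs)
  have "X (\<Sum>i\<in>B. f i) = (\<Sum>i\<in>B. X (f i))" for B :: "nat set" and f
    by (induction B rule: infinite_finite_induct) (auto simp: X_add)
  then show ?case
    using Cons by (simp add: sum.lessThan_Suc_shift X_scale del: sum.lessThan_Suc)
qed simp

lemma gen_eigenvector_induct [consumes 1, case_names add gen_eigenvector]:
  assumes "span gen_eigenvectors = UNIV"
    and add: "\<And>u v. P u \<Longrightarrow> P v \<Longrightarrow> P (u + v)"
    and gen: "\<And>l u. u \<in> gen_eigenspace l \<Longrightarrow> P u"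
  shows "P u"
proof -
  have "u \<in> span gen_eigenvectors" using assms(1) by simp
  then show ?thesis
  proof (induction rule: span_induct_alt)
    case base
    then show ?case using gen subspace_0[OF subspace_gen_eigenspace] by blast
  next
    case (step c g w)
    then show ?case using add gen subspace_scale[OF subspace_gen_eigenspace] by blast
  qed
qed

text \<open>Prescribing a scalar on each generalized eigenspace defines an operator, because the decomposition
  of a vector into generalized eigenvectors is unique.\<close>

lemma linear_extension_of_scalars:
  assumes "span gen_eigenvectors = UNIV"
  obtains Y where "\<And>u v. Y (u + v) = Y u + Y v" "\<And>c u. Y (c *\<^sub>s u) = c *\<^sub>s Y u"
    "\<And>l u. u \<in> gen_eigenspace l \<Longrightarrow> Y u = \<phi> l *\<^sub>s u"
proof -
  define D where "D u c \<longleftrightarrow> finite {l. c l \<noteq> 0} \<and> (\<forall>l. c l \<in> gen_eigenspace l) \<and>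
    (\<Sum>l | c l \<noteq> 0. c l) = u" for u and c :: "'f \<Rightarrow> 'v"
  have DI: "D u c" if "finite A" "\<And>l. l \<notin> A \<Longrightarrow> c l = 0" "\<And>l. c l \<in> gen_eigenspace l"
    "(\<Sum>l\<in>A. c l) = u" for A u c
  proof -
    have "{l. c l \<noteq> 0} \<subseteq> A" using that(2) by blast
    moreover from this have "(\<Sum>l | c l \<noteq> 0. c l) = (\<Sum>l\<in>A. c l)"
      by (intro sum.mono_neutral_left that) auto
    ultimately show ?thesis using that by (auto simp: D_def intro: finite_subset)
  qed
  have Dsum: "(\<Sum>l\<in>A. c l) = u" if "D u c" "finite A" "{l. c l \<noteq> 0} \<subseteq> A" for A u c
    using that sum.mono_neutral_left[OF that(2,3), of c] by (auto simp: D_def)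
  have Dadd: "D (u + v) (\<lambda>l. c l + d l)" if "D u c" "D v d" for u v c d
  proof (rule DI[of "{l. c l \<noteq> 0} \<union> {l. d l \<noteq> 0}"])
    show "(\<Sum>l\<in>{l. c l \<noteq> 0} \<union> {l. d l \<noteq> 0}. c l + d l) = u + v"
      using that Dsum[of u c "{l. c l \<noteq> 0} \<union> {l. d l \<noteq> 0}"]
        Dsum[of v d "{l. c l \<noteq> 0} \<union> {l. d l \<noteq> 0}"]
      by (auto simp: sum.distrib D_def)
  qed (use that in \<open>auto simp: D_def intro: subspace_add[OF subspace_gen_eigenspace]\<close>)
  have Dscale: "D (a *\<^sub>s u) (\<lambda>l. a *\<^sub>s c l)" if "D u c" for u a c
    by (rule DI[of "{l. c l \<noteq> 0}"])
      (use that in \<open>auto simp: D_def scale_sum_right[symmetric] intro: subspace_scale[OF subspace_gen_eigenspace]\<close>)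
  have Dsingle: "D u (\<lambda>k. if k = l then u else 0)" if "u \<in> gen_eigenspace l" for u l
    by (rule DI[of "{l}"]) (use that subspace_0[OF subspace_gen_eigenspace] in auto)
  have D0: "c l = 0" if "D 0 c" for c l
    using gen_eigenspaces_independent[of "{l. c l \<noteq> 0}" c l] that unfolding D_def by blast
  have Duniq: "c = d" if "D u c" "D u d" for u c d
  proof
    fix l
    have "D (u + (-1) *\<^sub>s u) (\<lambda>l. c l + (-1) *\<^sub>s d l)" by (intro Dadd Dscale that)
    then have "D 0 (\<lambda>l. c l - d l)" by simp
    from D0[OF this, of l] show "c l = d l" by simp
  qed
  have "\<exists>c. D u c" for u
  proof -
    have "u \<in> span gen_eigenvectors" using assms by simp
    then show ?thesis
    proof (induction rule: span_induct_alt)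
      case base
      have "D 0 (\<lambda>_. 0)" by (simp add: D_def subspace_0[OF subspace_gen_eigenspace])
      then show ?case by blast
    qed (use Dadd Dscale Dsingle in blast)
  qed
  then obtain c where c: "\<And>u. D u (c u)" by metis
  define Y where "Y u = (\<Sum>l | c u l \<noteq> 0. \<phi> l *\<^sub>s c u l)" for u
  have Ysup: "Y u = (\<Sum>l\<in>A. \<phi> l *\<^sub>s c u l)" if "finite A" "{l. c u l \<noteq> 0} \<subseteq> A" for A u
    unfolding Y_def by (rule sum.mono_neutral_left) (use that in auto)
  have cadd: "c (u + v) l = c u l + c v l" for u v l
    using Duniq[OF c Dadd[OF c c]] by meson
  have cscale: "c (a *\<^sub>s u) l = a *\<^sub>s c u l" for a u l
    using Duniq[OF c Dscale[OF c]] by meson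
  have fin: "finite {l. c u l \<noteq> 0}" for u using c by (simp add: D_def)
  show ?thesis
  proof
    fix u v
    let ?A = "{l. c u l \<noteq> 0} \<union> {l. c v l \<noteq> 0}"
    have "Y (u + v) = (\<Sum>l\<in>?A. \<phi> l *\<^sub>s c (u + v) l)"
      by (rule Ysup) (auto simp: fin cadd)
    also have "\<dots> = Y u + Y v"
      by (subst (1 2) Ysup[of ?A]) (auto simp: fin cadd scale_right_distrib sum.distrib)
    finally show "Y (u + v) = Y u + Y v" .
  next
    fix a u
    have "Y (a *\<^sub>s u) = (\<Sum>l | c u l \<noteq> 0. \<phi> l *\<^sub>s c (a *\<^sub>s u) l)"
      by (rule Ysup) (auto simp: fin cscale)
    also have "\<dots> = a *\<^sub>s Y u"
      by (simp add: cscale Y_def[of u] scale_sum_right mult.commute)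
    finally show "Y (a *\<^sub>s u) = a *\<^sub>s Y u" .
  next
    fix l u assume "u \<in> gen_eigenspace l"
    then have "c u = (\<lambda>k. if k = l then u else 0)" using Duniq[OF c Dsingle] by blast
    moreover have "Y u = (\<Sum>k\<in>{l}. \<phi> k *\<^sub>s c u k)" by (rule Ysup) (auto simp: calculation)
    ultimately show "Y u = \<phi> l *\<^sub>s u" by simp
  qed
qed

text \<open>A root \<open>l\<close> of the annihilating polynomial reduces its degree at the price of replacing \<open>u\<close> by
  \<open>shift l u\<close>, which does no harm by the closure property above.\<close>

lemma span_gen_eigenvectors_if_annihilated:
  assumes "\<And>p :: 'f poly. degree p > 0 \<Longrightarrow> \<exists>z. poly p z = 0"
    and "p \<noteq> 0" "poly_op p u = 0"
  shows "u \<in> span gen_eigenvectors"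
  using assms(2,3)
proof (induction "degree p" arbitrary: p u)
  case 0
  then obtain a where "p = [:a:]" "a \<noteq> 0" by (metis degree_eq_zeroE pCons_0_0)
  then show ?case using 0 by (simp add: span_zero)
next
  case (Suc n)
  then obtain l where l: "poly p l = 0" using assms(1)[of p] by auto
  have "poly_op (synthetic_div p l) (shift l u) = 0"
    using Suc.prems l poly_op_synthetic_div[of p u l] by simp
  moreover have "degree (synthetic_div p l) = n" "synthetic_div p l \<noteq> 0"
    using Suc.hyps(2) by (auto simp: degree_synthetic_div synthetic_div_eq_0_iff)
  ultimately have "shift l u \<in> span gen_eigenvectors" using Suc.hyps(1) by metis
  then show ?case by (rule span_gen_eigenvectors_shift)
qed

end

section \<open>Traces\<close>

definition fin_dim :: "'a::real_vector itself \<Rightarrow> bool" where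
  "fin_dim _ \<longleftrightarrow> (\<exists>B::'a set. finite B \<and> span B = UNIV)"

text \<open>For an independent \<open>B\<close> whose span is invariant under \<open>f\<close> this is the trace of the restriction
  of \<open>f\<close> to that span. The partial traces let a triangularizing basis be built up one vector at a
  time.\<close>

definition trace_on :: "'a::real_vector set \<Rightarrow> ('a \<Rightarrow> 'a) \<Rightarrow> real" where
  "trace_on B f = (\<Sum>b\<in>B. representation B (f b) b)"

definition lin_trace :: "('a::real_vector \<Rightarrow> 'a) \<Rightarrow> real" where
  "lin_trace = trace_on (extend_basis {})"

abbreviation basis_of :: "'a::real_vector set" where
  "basis_of \<equiv> extend_basis {}"

lemma independent_basis_of: "independent basis_of"
  by (rule independent_extend_basis[OF real_vector.independent_empty])

lemma span_basis_of: "span basis_of = UNIV"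
  by (rule span_extend_basis[OF real_vector.independent_empty])

lemma finite_if_independent:
  assumes "fin_dim TYPE('a::real_vector)" "independent (B :: 'a set)"
  shows "finite B"
proof -
  obtain C :: "'a set" where "finite C" "span C = UNIV" using assms by (auto simp: fin_dim_def)
  then show ?thesis using independent_span_bound[of C B] assms(2) by auto
qed

lemma linear_representation_real:
  assumes "independent B" "span B = UNIV"
  shows "linear (\<lambda>v. representation B v b)"
  by (rule linearI) (simp_all add: representation_add representation_scale assms)

lemma trace_on_basis_independent:
  fixes f :: "'a::real_vector \<Rightarrow> 'a"
  assumes f: "linear f"
    and B: "finite B" "independent B" "span B = UNIV"
    and C: "finite C" "independent C" "span C = UNIV"
  shows "trace_on B f = trace_on C f"
proof -
  have repB: "linear (\<lambda>v. representation B v b)" for b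
    using linear_representation_real B by blast
  have repC: "linear (\<lambda>v. representation C v b)" for b
    using linear_representation_real C by blast
  have expB: "(\<Sum>b\<in>B. representation B v b *\<^sub>R b) = v" for v
    using sum_representation_eq[of B v B] B by auto
  have expC: "(\<Sum>b\<in>C. representation C v b *\<^sub>R b) = v" for v
    using sum_representation_eq[of C v C] C by auto
  have "trace_on B f = (\<Sum>b\<in>B. representation B (\<Sum>c\<in>C. representation C (f b) c *\<^sub>R c) b)"
    by (simp add: trace_on_def expC)
  also have "\<dots> = (\<Sum>b\<in>B. \<Sum>c\<in>C. representation C (f b) c * representation B c b)"
    by (simp add: linear_sum[OF repB] linear_scale[OF repB])
  also have "\<dots> = (\<Sum>c\<in>C. \<Sum>b\<in>B. representation C (f b) c * representation B c b)"
    by (rule sum.swap)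
  also have "\<dots> = (\<Sum>c\<in>C. representation C (f (\<Sum>b\<in>B. representation B c b *\<^sub>R b)) c)"
    by (simp add: linear_sum[OF repC] linear_scale[OF repC] linear_sum[OF f] linear_scale[OF f] mult.commute)
  also have "\<dots> = trace_on C f" by (simp add: trace_on_def expB)
  finally show ?thesis .
qed

lemma lin_trace_add: "lin_trace (\<lambda>v. f v + g v) = lin_trace f + lin_trace g"
  by (simp add: lin_trace_def trace_on_def representation_add independent_basis_of span_basis_of
      sum.distrib)

lemma lin_trace_scale: "lin_trace (\<lambda>v. c *\<^sub>R f v) = c * lin_trace f"
  by (simp add: lin_trace_def trace_on_def representation_scale independent_basis_of span_basis_of
      sum_distrib_left)

lemma lin_trace_uminus: "lin_trace (\<lambda>v. - f v) = - lin_trace f"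
  using lin_trace_scale[of "-1" f] by simp

lemma lin_trace_diff: "lin_trace (\<lambda>v. f v - g v) = lin_trace f - lin_trace g"
  using lin_trace_add[of f "\<lambda>v. - g v"] by (simp add: lin_trace_uminus)

lemma lin_trace_0: "lin_trace (\<lambda>v. 0) = 0"
  using lin_trace_scale[of 0 "\<lambda>v. 0"] by simp

lemma lin_trace_commute:
  fixes f g :: "'a::real_vector \<Rightarrow> 'a"
  assumes fd: "fin_dim TYPE('a)" and f: "linear f" and g: "linear g"
  shows "lin_trace (\<lambda>v. f (g v)) = lin_trace (\<lambda>v. g (f v))"
proof -
  let ?B = "basis_of :: 'a set"
  have fin: "finite ?B" using finite_if_independent[OF fd independent_basis_of] .
  have rep: "linear (\<lambda>v. representation ?B v b)" for b
    using linear_representation_real independent_basis_of span_basis_of by blast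
  have ex: "v = (\<Sum>b\<in>?B. representation ?B v b *\<^sub>R b)" for v
    by (rule sum_representation_eq[symmetric]) (use fin independent_basis_of in \<open>auto simp: span_basis_of\<close>)
  have *: "lin_trace (\<lambda>v. h (k v)) =
      (\<Sum>b\<in>?B. \<Sum>c\<in>?B. representation ?B (k b) c * representation ?B (h c) b)"
    if h: "linear h" for h k :: "'a \<Rightarrow> 'a"
  proof -
    have hw: "h w = (\<Sum>c\<in>?B. representation ?B w c *\<^sub>R h c)" for w
      using arg_cong[OF ex[of w], of h] by (simp add: linear_sum[OF h] linear_scale[OF h])
    have "representation ?B (h w) b =
        (\<Sum>c\<in>?B. representation ?B w c * representation ?B (h c) b)" for w b
      using arg_cong[OF hw[of w], of "\<lambda>v. representation ?B v b"]
      by (simp add: linear_sum[OF rep] linear_scale[OF rep])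
    then show ?thesis unfolding lin_trace_def trace_on_def by (intro sum.cong refl)
  qed
  show ?thesis
    unfolding *[OF f] *[OF g] by (subst sum.swap) (simp add: mult.commute)
qed

lemma operator_space_real:
  assumes "linear W" shows "operator_space (\<lambda>c v. c *\<^sub>R v) W"
  using assms by unfold_locales (auto simp: algebra_simps linear_add linear_scale)

text \<open>Triangularization: as long as an invariant subspace is proper, some generalized eigenvector lies
  outside it, and the last iterate of \<open>W - r\<close> on it that still lies outside extends the basis by a
  vector with diagonal entry \<open>r \<ge> 0\<close>. Thus the trace is a sum of nonnegative terms, and when it
  vanishes the diagonal does, leaving a strictly triangular operator.\<close>

lemma nonneg_gen_eigenvalues_trace:
  fixes W :: "'a::real_vector \<Rightarrow> 'a"
  assumes fd: "fin_dim TYPE('a)" and W: "linear W"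
    and sp: "span (\<Union>r\<in>{0..}. operator_space.gen_eigenspace (\<lambda>c v. c *\<^sub>R v) W r) = UNIV"
    and tr: "lin_trace W = 0"
  obtains n where "\<And>u. (W ^^ n) u = 0"
proof -
  interpret W: operator_space "\<lambda>c v. c *\<^sub>R v" W using operator_space_real[OF W] .
  define G where "G = (\<Union>r\<in>{0..}. W.gen_eigenspace r)"
  have spG: "span G = UNIV" using sp by (simp add: G_def)
  \<comment> \<open>A basis \<open>C\<close> of an invariant subspace on which the claim holds; a largest one spans everything.\<close>
  define Q where "Q C \<longleftrightarrow> independent C \<and> (\<forall>u\<in>span C. W u \<in> span C) \<and> 0 \<le> trace_on C W \<and>
      (trace_on C W = 0 \<longrightarrow> (\<exists>n. \<forall>u\<in>span C. (W ^^ n) u = 0))" for C :: "'a set"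
  obtain S :: "'a set" where S: "finite S" "span S = UNIV" using fd by (auto simp: fin_dim_def)
  have "card C \<le> card S" if "independent C" for C :: "'a set"
    using independent_span_bound[OF S(1) that] S(2) by simp
  moreover have "Q {}" using real_vector.independent_empty linear_0[OF W]
    by (auto simp: Q_def trace_on_def intro!: exI[of _ 0])
  moreover have "independent C" if "Q C" for C using that by (simp add: Q_def)
  ultimately obtain C where C: "Q C" and max: "\<And>D. Q D \<Longrightarrow> card D \<le> card C"
    using ex_has_greatest_nat[of Q "{}" card "Suc (card S)"] by (auto simp: less_Suc_eq_le)
  have indC: "independent C" and WC: "\<And>u. u \<in> span C \<Longrightarrow> W u \<in> span C" using C by (auto simp: Q_def)
  have finC: "finite C" using finite_if_independent[OF fd indC] .
  have "span C = UNIV"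
  proof (rule ccontr)
    assume ne: "span C \<noteq> UNIV"
    have "\<not> G \<subseteq> span C"
      using ne spG span_minimal[OF _ subspace_span, of G C] by auto
    then obtain r g where r: "0 \<le> r" "g \<in> W.gen_eigenspace r" "g \<notin> span C"
      by (auto simp: G_def)
    then obtain n where n: "(W.shift r ^^ n) g = 0" by (auto simp: W.gen_eigenspace_def)
    define m where "m = (LEAST m. (W.shift r ^^ m) g \<in> span C)"
    have m1: "(W.shift r ^^ m) g \<in> span C"
      unfolding m_def by (rule LeastI[of _ n]) (simp add: n span_zero)
    have "m \<noteq> 0" using m1 r(3) by (metis funpow_0)
    then obtain k where k: "m = Suc k" by (cases m) auto
    define b where "b = (W.shift r ^^ k) g"
    have b: "b \<notin> span C"
      using not_less_Least[of k "\<lambda>m. (W.shift r ^^ m) g \<in> span C"] k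
      by (simp add: b_def m_def)
    define s where "s = W b - r *\<^sub>R b"
    have s: "s \<in> span C" using m1 by (simp add: k b_def W.shift_def s_def)
    have Wb: "W b = r *\<^sub>R b + s" by (simp add: s_def)
    let ?D = "insert b C"
    have bC: "b \<notin> C" using b span_base by blast
    have indD: "independent ?D" using indC b by (simp add: independent_insert)
    have repD: "representation ?D u = representation C u" if "u \<in> span C" for u
      by (rule representation_extend[OF indD that]) auto
    have rep0: "representation C u b = 0" for u
      using representation_ne_zero[of C u b] bC by blast
    have CD: "span C \<subseteq> span ?D" by (rule span_mono) auto
    have b1: "representation ?D (W b) b = r"
    proof -
      have "representation ?D (W b) b = r * representation ?D b b + representation ?D s b"
        unfolding Wb using s CD
        by (simp add: representation_add[OF indD] representation_scale[OF indD] span_base span_scale subset_iff)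
      then show ?thesis
        using representation_basis[OF indD, of b] repD[OF s] rep0 by simp
    qed
    have trD: "trace_on ?D W = r + trace_on C W"
      unfolding trace_on_def using bC finC b1
      by (simp add: repD WC span_base)
    have WD: "W u \<in> span ?D" if u: "u \<in> span ?D" for u
    proof -
      obtain c where "u - c *\<^sub>R b \<in> span C" using u unfolding span_breakdown_eq by blast
      then have "W (u - c *\<^sub>R b) \<in> span ?D" using WC CD by blast
      moreover have "s \<in> span ?D" "b \<in> span ?D" using CD s span_base[of b ?D] by auto
      then have "W b \<in> span ?D" unfolding Wb by (intro span_add span_scale)
      ultimately have "W (u - c *\<^sub>R b) + c *\<^sub>R W b \<in> span ?D" by (intro span_add span_scale)
      then show ?thesis by (simp add: linear_diff[OF W] linear_scale[OF W])
    qed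
    have "\<exists>n. \<forall>u\<in>span ?D. (W ^^ n) u = 0" if "trace_on ?D W = 0"
    proof -
      have 0: "r = 0" "trace_on C W = 0" using that r(1) C by (auto simp: trD Q_def)
      then obtain n where n: "\<forall>u\<in>span C. (W ^^ n) u = 0" using C by (auto simp: Q_def)
      have "(W ^^ Suc n) u = 0" if u: "u \<in> span ?D" for u
      proof -
        obtain c where c: "u - c *\<^sub>R b \<in> span C" using u unfolding span_breakdown_eq by blast
        have "W u = W (u - c *\<^sub>R b) + c *\<^sub>R W b" by (simp add: linear_diff[OF W] linear_scale[OF W])
        also have "\<dots> \<in> span C"
          using WC[OF c] s 0(1) by (simp add: Wb span_add span_scale)
        finally show ?thesis using n by (simp add: funpow_swap1)
      qed
      then show ?thesis by blast
    qed
    moreover have "0 \<le> trace_on ?D W" using trD r(1) C by (simp add: Q_def)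
    ultimately have "Q ?D" unfolding Q_def using indD WD by blast
    then show False using max[of ?D] bC finC by simp
  qed
  moreover have "trace_on C W = lin_trace W"
    unfolding lin_trace_def
    by (rule trace_on_basis_independent[OF W finC indC calculation
          finite_if_independent[OF fd independent_basis_of] independent_basis_of span_basis_of])
  ultimately obtain n where "\<forall>u\<in>UNIV. (W ^^ n) u = 0"
    using C tr unfolding Q_def by auto
  then show ?thesis using that[of n] by simp
qed

section \<open>The conjugate semisimple part of a derivation\<close>

text \<open>The complexification of a real vector space is carried by pairs of real and imaginary part; only
  the complex scalars need a name, since addition of pairs is componentwise.\<close>

definition cscale :: "complex \<Rightarrow> 'a::real_vector \<times> 'a \<Rightarrow> 'a \<times> 'a" where
  "cscale z p = (Re z *\<^sub>R fst p - Im z *\<^sub>R snd p, Re z *\<^sub>R snd p + Im z *\<^sub>R fst p)"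

definition cconj :: "'a::real_vector \<times> 'a \<Rightarrow> 'a \<times> 'a" where
  "cconj p = (fst p, - snd p)"

definition cbracket :: "('a::real_vector \<Rightarrow> 'a \<Rightarrow> 'a) \<Rightarrow> 'a \<times> 'a \<Rightarrow> 'a \<times> 'a \<Rightarrow> 'a \<times> 'a" where
  "cbracket br p q = (br (fst p) (fst q) - br (snd p) (snd q), br (fst p) (snd q) + br (snd p) (fst q))"

lemma operator_space_complexify:
  assumes "linear X" shows "operator_space cscale (map_prod X X)"
  by unfold_locales
    (auto simp: cscale_def prod_eq_iff algebra_simps scaleR_add_left scaleR_diff_left
      linear_add[OF assms] linear_diff[OF assms] linear_scale[OF assms])

lemma linearly_dependent_sequence:
  fixes f :: "nat \<Rightarrow> 'a::real_vector"
  assumes "fin_dim TYPE('a)"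
  obtains n c where "\<exists>i<n. c i \<noteq> 0" "(\<Sum>i<n. c i *\<^sub>R f i) = 0"
proof -
  obtain B :: "'a set" where B: "finite B" "span B = UNIV" using assms by (auto simp: fin_dim_def)
  let ?n = "Suc (card B)"
  show ?thesis
  proof (cases "inj_on f {..<?n}")
    case True
    then have "card (f ` {..<?n}) = ?n" by (simp add: card_image)
    then have "dependent (f ` {..<?n})"
      using independent_span_bound[OF B(1), of "f ` {..<?n}"] B(2) by auto
    then obtain u where u: "\<exists>v\<in>f ` {..<?n}. u v \<noteq> 0" "(\<Sum>v\<in>f ` {..<?n}. u v *\<^sub>R v) = 0"
      by (auto simp: dependent_finite)
    show ?thesis
    proof (rule that)
      show "\<exists>i<?n. u (f i) \<noteq> 0" using u(1) by blast
      show "(\<Sum>i<?n. u (f i) *\<^sub>R f i) = 0"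
        using u(2) by (simp add: sum.reindex[OF True] del: sum.lessThan_Suc)
    qed
  next
    case False
    then obtain i j where ij: "i < ?n" "j < ?n" "i \<noteq> j" "f i = f j" by (auto simp: inj_on_def)
    let ?c = "\<lambda>k. (if k = i then 1 else 0) - (if k = j then 1 else (0::real))"
    have "(\<Sum>k<?n. ?c k *\<^sub>R f k) = f i - f j"
      using ij by (simp add: scaleR_diff_left sum_subtractf if_distrib[of "\<lambda>c. c *\<^sub>R _"]
          sum.delta' del: sum.lessThan_Suc cong: if_cong)
    then show ?thesis using ij by (intro that[of ?n ?c]) auto
  qed
qed

text \<open>The iterates of a real vector under \<open>X\<close> are linearly dependent, so a nonzero polynomial
  annihilates it; over the complex numbers that polynomial splits into linear factors.\<close>

lemma span_complex_gen_eigenvectors: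
  fixes X :: "'a::real_vector \<Rightarrow> 'a"
  assumes fd: "fin_dim TYPE('a)" and X: "linear X"
  shows "module.span cscale
    (\<Union>l. operator_space.gen_eigenspace cscale (map_prod X X) l) = UNIV"
proof -
  interpret C: operator_space cscale "map_prod X X" using operator_space_complexify[OF X] .
  have real: "(a, 0) \<in> C.span C.gen_eigenvectors" for a
  proof -
    obtain n c where c: "\<exists>i<n. c i \<noteq> 0" "(\<Sum>i<n. c i *\<^sub>R (X ^^ i) a) = 0"
      using linearly_dependent_sequence[OF fd, of "\<lambda>i. (X ^^ i) a"] by blast
    define p where "p = Poly (map (\<lambda>i. complex_of_real (c i)) [0..<n])"
    have "coeff p i = complex_of_real (c i)" if "i < n" for i
      using that by (simp add: p_def nth_default_def)
    then have "p \<noteq> 0" using c(1) by force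
    have pow: "(map_prod X X ^^ i) (a, 0) = ((X ^^ i) a, 0)" for i
      by (induction i) (auto simp: linear_0[OF X])
    have sum: "(\<Sum>i\<in>A. cscale (complex_of_real (c i)) (f i, 0)) = ((\<Sum>i\<in>A. c i *\<^sub>R f i), 0)"
      for A and f :: "nat \<Rightarrow> 'a"
      by (induction A rule: infinite_finite_induct) (auto simp: cscale_def zero_prod_def)
    have "C.poly_op p (a, 0) = 0"
      using c(2) by (simp add: p_def C.poly_op_Poly pow sum zero_prod_def)
    moreover have "\<exists>z. poly q z = 0" if "degree q > 0" for q :: "complex poly"
      using fundamental_theorem_of_algebra[of q] that by (auto simp: constant_degree)
    ultimately show ?thesis
      using C.span_gen_eigenvectors_if_annihilated \<open>p \<noteq> 0\<close> by blast
  qed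
  have "p \<in> C.span C.gen_eigenvectors" for p
  proof -
    have "p = (fst p, 0) + cscale \<i> (snd p, 0)" by (auto simp: cscale_def prod_eq_iff)
    then show ?thesis using real by (metis C.span_add C.span_scale)
  qed
  then show ?thesis by blast
qed

lemma linear_funpow:
  fixes f :: "'a::real_vector \<Rightarrow> 'a"
  assumes "linear f" shows "linear (f ^^ n)"
proof (induction n)
  case 0
  show ?case by (auto intro: linearI)
next
  case (Suc n)
  then show ?case unfolding funpow.simps by (rule linear_compose[OF _ assms])
qed

lemma locally_nilpotent_imp_nilpotent:
  fixes X :: "'a::real_vector \<Rightarrow> 'a"
  assumes fd: "fin_dim TYPE('a)" and X: "linear X" and nil: "\<And>a. \<exists>n. (X ^^ n) a = 0"
  shows "\<exists>n. \<forall>a. (X ^^ n) a = 0"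
proof -
  obtain B :: "'a set" where B: "finite B" "span B = UNIV" using fd by (auto simp: fin_dim_def)
  obtain n where n: "\<And>a. (X ^^ n a) a = 0" using nil by metis
  define N where "N = (\<Sum>b\<in>B. n b)"
  have lin: "linear (X ^^ k)" for k
    by (rule linear_funpow[OF X])
  have "(X ^^ N) b = 0" if "b \<in> B" for b
  proof -
    have "n b \<le> N" unfolding N_def using B(1) that by (intro member_le_sum) auto
    then have "(X ^^ N) b = (X ^^ (N - n b)) ((X ^^ n b) b)"
      by (simp flip: funpow_add[THEN fun_cong, unfolded o_apply])
    then show ?thesis by (simp add: n linear_0[OF lin])
  qed
  then have "(X ^^ N) a = 0" for a
    using linear_eq_0_on_span[OF lin, of B N a] B(2) by auto
  then show ?thesis by blast
qed

text \<open>
  Let \<open>Y\<close> act on the generalized eigenspace of \<open>X\<close> at \<open>l\<close>, inside the complexification, as the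
  scalar \<open>cnj l\<close>. It commutes with conjugation because conjugation exchanges the generalized
  eigenspaces at \<open>l\<close> and \<open>cnj l\<close>, so \<open>Y\<close> is a real operator. It takes values in the range of \<open>X\<close>
  because it vanishes at \<open>l = 0\<close> while \<open>X\<close> is invertible on the other generalized eigenspaces. For a
  derivation \<open>X\<close> the bracket maps the eigenspaces at \<open>l\<close> and \<open>m\<close> into the one at \<open>l + m\<close>; as
  conjugation is additive, \<open>Y\<close> is a derivation too. Finally \<open>X \<circ> Y\<close> has the generalized eigenvalues
  \<open>(cmod l)\<^sup>2 \<ge> 0\<close>, so trace zero leaves no eigenvalue but \<open>0\<close>.

  In terms of the additive Jordan decomposition, \<open>Y\<close> is the complex conjugate of the semisimple part
  of \<open>X\<close>.
\<close>

lemma conjugate_semisimple_part: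
  fixes X :: "'a::real_vector \<Rightarrow> 'a"
  assumes fd: "fin_dim TYPE('a)" and X: "linear X"
    and bil: "bilinear br" and der: "\<And>a b. X (br a b) = br (X a) b + br a (X b)"
  obtains Y where "linear Y" "\<And>u. Y u \<in> range X"
    "\<And>a b. Y (br a b) = br (Y a) b + br a (Y b)"
    "lin_trace (\<lambda>v. X (Y v)) = 0 \<longrightarrow> (\<exists>n. \<forall>a. (X ^^ n) a = 0)"
proof -
  interpret C: operator_space cscale "map_prod X X" using operator_space_complexify[OF X] .
  let ?XC = "map_prod X X" and ?cs = cscale
  have sp: "C.span C.gen_eigenvectors = UNIV" by (rule span_complex_gen_eigenvectors[OF fd X])
  obtain YC where YC_add: "\<And>u v. YC (u + v) = YC u + YC v"
    and YC_scale: "\<And>c u. YC (?cs c u) = ?cs c (YC u)"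
    and YC_gen: "\<And>l u. u \<in> C.gen_eigenspace l \<Longrightarrow> YC u = ?cs (cnj l) u"
    using C.linear_extension_of_scalars[OF sp, of cnj] by blast
  note induct = C.gen_eigenvector_induct[OF sp, consumes 0, case_names add gen_eigenvector]

  have conj_add: "cconj (u + v) = cconj u + cconj v" for u v :: "'a \<times> 'a"
    by (simp add: cconj_def prod_eq_iff)
  have conj_scale: "cconj (?cs z u) = ?cs (cnj z) (cconj u)" for z and u :: "'a \<times> 'a"
    by (simp add: cconj_def cscale_def prod_eq_iff)
  have "C.shift (cnj l) (cconj u) = cconj (C.shift l u)" for l u
    by (simp add: C.shift_def cconj_def cscale_def prod_eq_iff linear_neg[OF X])
  then have "(C.shift (cnj l) ^^ n) (cconj u) = cconj ((C.shift l ^^ n) u)" for l u n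
    by (induction n) auto
  moreover have "cconj (0 :: 'a \<times> 'a) = 0" by (simp add: cconj_def prod_eq_iff)
  ultimately have gen_conj: "cconj u \<in> C.gen_eigenspace (cnj l)" if "u \<in> C.gen_eigenspace l" for u l
    using that unfolding C.gen_eigenspace_def mem_Collect_eq by metis
  have YC_conj: "YC (cconj u) = cconj (YC u)" for u
  proof (induction u rule: induct)
    case (gen_eigenvector l u)
    then show ?case by (simp add: YC_gen[OF gen_conj] YC_gen conj_scale)
  qed (simp add: conj_add YC_add)

  define Y where "Y a = fst (YC (a, 0))" for a
  have YC_real: "YC (a, 0) = (Y a, 0)" for a
  proof -
    have "snd (YC (a, 0)) = - snd (YC (a, 0))"
      using YC_conj[of "(a, 0)"] by (simp add: cconj_def prod_eq_iff)
    then have "2 *\<^sub>R snd (YC (a, 0)) = 0" by (simp add: scaleR_2 flip: eq_neg_iff_add_eq_0)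
    then show ?thesis by (simp add: Y_def prod_eq_iff)
  qed
  have YC_eq: "YC u = (Y (fst u), Y (snd u))" for u
  proof -
    have "u = (fst u, 0) + ?cs \<i> (snd u, 0)" by (auto simp: cscale_def prod_eq_iff)
    then have "YC u = YC (fst u, 0) + ?cs \<i> (YC (snd u, 0))" by (metis YC_add YC_scale)
    then show ?thesis by (simp add: YC_real cscale_def)
  qed
  have linY: "linear Y"
  proof (rule linearI)
    show "Y (a + b) = Y a + Y b" for a b
      using YC_add[of "(a, 0)" "(b, 0)"] by (simp add: YC_real)
    show "Y (r *\<^sub>R a) = r *\<^sub>R Y a" for r a
      using YC_scale[of "complex_of_real r" "(a, 0)"] by (simp add: YC_real cscale_def)
  qed

  have YC_range: "YC u \<in> range ?XC" for u
  proof (induction u rule: induct)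
    case (add u v)
    obtain a where a: "YC u = ?XC a" using add(1) by (rule rangeE)
    obtain b where b: "YC v = ?XC b" using add(2) by (rule rangeE)
    have "YC (u + v) = ?XC (a + b)" by (simp only: YC_add C.X_add a b)
    then show ?case by (rule range_eqI)
  next
    case (gen_eigenvector l u)
    show ?case
    proof (cases "l = 0")
      case True
      then have "YC u = 0" using YC_gen[OF gen_eigenvector] by simp
      then have "YC u = ?XC 0" by (simp only: C.X_0)
      then show ?thesis by (rule range_eqI)
    next
      case False
      then obtain w where "C.shift 0 w = u"
        using C.shift_surj_on_gen_eigenspace[of 0 l u] gen_eigenvector by auto
      then have "YC u = ?XC (?cs (cnj l) w)"
        using YC_gen[OF gen_eigenvector] by (simp add: C.shift_def C.X_scale)
      then show ?thesis by (rule range_eqI)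
    qed
  qed
  have range: "Y a \<in> range X" for a
  proof -
    obtain w where "YC (a, 0) = ?XC w" using YC_range by (rule rangeE)
    then have "Y a = X (fst w)" by (simp add: Y_def)
    then show ?thesis by (rule range_eqI)
  qed

  have cbr_add: "cbracket br (u + v) w = cbracket br u w + cbracket br v w"
    "cbracket br w (u + v) = cbracket br w u + cbracket br w v" for u v w
    by (simp_all add: cbracket_def prod_eq_iff bilinear_ladd[OF bil] bilinear_radd[OF bil])
  have cbr_scale: "cbracket br (?cs z u) w = ?cs z (cbracket br u w)"
    "cbracket br w (?cs z u) = ?cs z (cbracket br w u)" for u w z
    by (simp_all add: cbracket_def cscale_def prod_eq_iff bilinear_ladd[OF bil] bilinear_radd[OF bil]
        bilinear_lsub[OF bil] bilinear_rsub[OF bil] bilinear_lmul[OF bil] bilinear_rmul[OF bil]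
        algebra_simps)
  have cbr_0: "cbracket br 0 w = 0" "cbracket br w 0 = 0" for w
    by (simp_all add: cbracket_def prod_eq_iff bilinear_lzero[OF bil] bilinear_rzero[OF bil])
  have der_shift: "C.shift (l + m) (cbracket br u w) =
      cbracket br (C.shift l u) w + cbracket br u (C.shift m w)" for l m u w
    by (simp add: C.shift_def cbracket_def cscale_def prod_eq_iff der bilinear_ladd[OF bil]
        bilinear_radd[OF bil] bilinear_lsub[OF bil] bilinear_rsub[OF bil] bilinear_lmul[OF bil]
        bilinear_rmul[OF bil] linear_add[OF X] linear_diff[OF X] algebra_simps scaleR_add_left)
  \<comment> \<open>The Leibniz rule for \<open>shift (l + m)\<close> lowers one of the two nilpotency degrees in each term.\<close>
  have "(C.shift (l + m) ^^ (i + j)) (cbracket br u w) = 0"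
    if "(C.shift l ^^ i) u = 0" "(C.shift m ^^ j) w = 0" for l m i j u w
    using that
  proof (induction "i + j" arbitrary: i j u w)
    case 0
    then show ?case by (simp add: cbr_0)
  next
    case (Suc k)
    show ?case
    proof (cases "i = 0 \<or> j = 0")
      case True
      then show ?thesis using Suc.prems by (auto simp: cbr_0)
    next
      case False
      then obtain i' j' where ij: "i = Suc i'" "j = Suc j'" by (metis not0_implies_Suc)
      have "(C.shift (l + m) ^^ (i' + j)) (cbracket br (C.shift l u) w) = 0"
        by (rule Suc.hyps(1)) (use Suc.hyps(2) Suc.prems ij in \<open>auto simp: funpow_swap1\<close>)
      moreover have "(C.shift (l + m) ^^ (i + j')) (cbracket br u (C.shift m w)) = 0"
        by (rule Suc.hyps(1)) (use Suc.hyps(2) Suc.prems ij in \<open>auto simp: funpow_swap1\<close>)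
      moreover have "i' + j = k" "i + j' = k" "i + j = Suc k" using Suc.hyps(2) ij by auto
      ultimately show ?thesis
        by (simp add: funpow_Suc_right der_shift C.funpow_shift_add del: funpow.simps)
    qed
  qed
  then have gen_cbr: "cbracket br u w \<in> C.gen_eigenspace (l + m)"
    if "u \<in> C.gen_eigenspace l" "w \<in> C.gen_eigenspace m" for l m u w
    using that unfolding C.gen_eigenspace_def by blast
  have derYC: "YC (cbracket br u w) = cbracket br (YC u) w + cbracket br u (YC w)" for u w
  proof (induction u rule: induct)
    case (add u v)
    then show ?case by (simp add: cbr_add YC_add)
  next
    case (gen_eigenvector l u)
    note u = gen_eigenvector
    show ?case
    proof (induction w rule: induct)
      case (add v w)
      then show ?case by (simp add: cbr_add YC_add)
    next
      case (gen_eigenvector m w)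
      then show ?case using u
        by (simp add: YC_gen[OF gen_cbr[OF u gen_eigenvector]] YC_gen cbr_scale C.scale_left_distrib)
    qed
  qed
  have derY: "Y (br a b) = br (Y a) b + br a (Y b)" for a b
    using derYC[of "(a, 0)" "(b, 0)"]
    by (simp add: cbracket_def YC_real bilinear_lzero[OF bil] bilinear_rzero[OF bil])

  have nil: "\<exists>n. \<forall>a. (X ^^ n) a = 0" if tr: "lin_trace (\<lambda>v. X (Y v)) = 0"
  proof -
    define W where "W v = X (Y v)" for v
    have linW: "linear W" unfolding W_def using linear_compose[OF linY X] by (simp add: o_def)
    interpret R: operator_space "\<lambda>c v. c *\<^sub>R v" W using operator_space_real[OF linW] .
    have gen: "fst u \<in> R.gen_eigenspace ((cmod l)\<^sup>2) \<and> snd u \<in> R.gen_eigenspace ((cmod l)\<^sup>2)"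
      if u: "u \<in> C.gen_eigenspace l" for u l
    proof -
      let ?r = "(cmod l)\<^sup>2"
      \<comment> \<open>On the generalized eigenspace at \<open>l\<close>, the operator \<open>X \<circ> Y - (cmod l)\<^sup>2\<close> is \<open>cnj l\<close> times
          the locally nilpotent \<open>X - l\<close>.\<close>
      define S where "S = map_prod (R.shift ?r) (R.shift ?r)"
      have S: "S w = ?cs (cnj l) (C.shift l w)" if "w \<in> C.gen_eigenspace l" for w
      proof -
        have "S w = ?XC (YC w) - ?cs (complex_of_real ?r) w"
          by (simp add: S_def R.shift_def W_def YC_eq cscale_def prod_eq_iff)
        also have "\<dots> = ?cs (cnj l) (?XC w) - ?cs (cnj l * l) w"
          by (simp only: YC_gen[OF that] C.X_scale complex_norm_square mult.commute)
        finally show ?thesis by (simp add: C.shift_def C.scale_right_diff_distrib)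
      qed
      have "(S ^^ n) u = ?cs (cnj l ^ n) ((C.shift l ^^ n) u) \<and> (C.shift l ^^ n) u \<in> C.gen_eigenspace l"
        for n
      proof (induction n)
        case (Suc n)
        then have "(S ^^ Suc n) u = ?cs (cnj l) (C.shift l (?cs (cnj l ^ n) ((C.shift l ^^ n) u)))"
          using S[OF C.subspace_scale[OF C.subspace_gen_eigenspace]] by simp
        then show ?case using Suc by (simp add: C.shift_scale C.shift_gen_eigenspace)
      qed (use u in auto)
      moreover obtain n where "(C.shift l ^^ n) u = 0" using u by (auto simp: C.gen_eigenspace_def)
      ultimately have "(S ^^ n) u = 0" by simp
      moreover have "(S ^^ n) u = ((R.shift ?r ^^ n) (fst u), (R.shift ?r ^^ n) (snd u))" for n
        by (induction n) (auto simp: S_def)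
      ultimately show ?thesis by (auto simp: R.gen_eigenspace_def prod_eq_iff)
    qed
    have "fst u \<in> span (\<Union>r\<in>{0..}. R.gen_eigenspace r)" for u :: "'a \<times> 'a"
    proof (induction u rule: induct)
      case (add u v)
      then show ?case by (simp add: span_add)
    next
      case (gen_eigenvector l u)
      then have "fst u \<in> R.gen_eigenspace ((cmod l)\<^sup>2)" using gen by blast
      then show ?case by (intro span_base UN_I[of "(cmod l)\<^sup>2"]) simp_all
    qed
    then have "span (\<Union>r\<in>{0..}. R.gen_eigenspace r) = UNIV"
      by (metis UNIV_eq_I fst_conv)
    moreover have "lin_trace W = 0" using tr by (simp add: W_def[abs_def])
    ultimately obtain n where n: "\<And>u. (W ^^ n) u = 0"
      using nonneg_gen_eigenvalues_trace[OF fd linW] by blast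
    have shift0: "R.shift 0 = W" "C.shift 0 = ?XC" by (auto simp: R.shift_def C.shift_def fun_eq_iff)
    have all0: "u \<in> C.gen_eigenspace 0" for u
    proof (induction u rule: induct)
      case (add u v)
      then show ?case using C.subspace_add[OF C.subspace_gen_eigenspace] by blast
    next
      case (gen_eigenvector l u)
      show ?case
      proof (cases "l = 0")
        case False
        have "fst u = 0 \<and> snd u = 0"
          using gen[OF gen_eigenvector] False n
            R.funpow_shift_inj_on_gen_eigenspace[of 0 "(cmod l)\<^sup>2" _ n] by (simp add: shift0)
        then have "u = 0" by (simp add: prod_eq_iff)
        then show ?thesis using C.subspace_0[OF C.subspace_gen_eigenspace] by simp
      qed (use gen_eigenvector in simp)
    qed
    have "\<exists>n. (X ^^ n) a = 0" for a
    proof -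
      obtain n where "(?XC ^^ n) (a, 0) = 0"
        using all0[of "(a, 0)"] by (auto simp: C.gen_eigenspace_def shift0)
      moreover have "(?XC ^^ n) (a, 0) = ((X ^^ n) a, (X ^^ n) 0)" for n
        by (induction n) auto
      ultimately show ?thesis by (auto simp: prod_eq_iff)
    qed
    then show ?thesis by (rule locally_nilpotent_imp_nilpotent[OF fd X])
  qed
  show ?thesis using that[OF linY range derY] nil by blast
qed

section \<open>Engel's theorem\<close>

lemma dim_less_of_subspace:
  fixes S T :: "'a::real_vector set"
  assumes fd: "fin_dim TYPE('a)" and S: "subspace S" "S \<subseteq> T" and x: "x \<in> T" "x \<notin> S"
  shows "dim S < dim T"
proof -
  obtain C where C: "C \<subseteq> S" "independent C" "S \<subseteq> span C" "card C = dim S"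
    using basis_exists by blast
  then have "x \<notin> span C" using x(2) S(1) span_minimal by blast
  then have ind: "independent (insert x C)" and "x \<notin> C"
    using C(2) span_base by (auto simp: independent_insert)
  obtain D where D: "insert x C \<subseteq> D" "D \<subseteq> T" "independent D" "T \<subseteq> span D"
    using maximal_independent_subset_extend[OF _ ind, of T] C(1) S(2) x(1) by blast
  have "card (insert x C) \<le> card D"
    using D finite_if_independent[OF fd] by (intro card_mono) auto
  then show ?thesis
    using basis_card_eq_dim[OF D(2,4,3)] C finite_if_independent[OF fd C(2)] \<open>x \<notin> C\<close> by simp
qed

locale lie_algebra =
  fixes br :: "'a::real_vector \<Rightarrow> 'a \<Rightarrow> 'a"
  assumes fin_dim_lie: "fin_dim_lie_algebra br"
begin

lemma fd: "fin_dim TYPE('a)"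
  using fin_dim_lie by (simp add: fin_dim_lie_algebra_def fin_dim_def)

lemma bil: "bilinear br"
  using fin_dim_lie by (simp add: fin_dim_lie_algebra_def)

lemma br_self: "br x x = 0"
  using fin_dim_lie by (simp add: fin_dim_lie_algebra_def)

lemmas br_add_left = bilinear_ladd[OF bil]
  and br_add_right = bilinear_radd[OF bil]
  and br_diff_left = bilinear_lsub[OF bil]
  and br_diff_right = bilinear_rsub[OF bil]
  and br_scale_left = bilinear_lmul[OF bil]
  and br_scale_right = bilinear_rmul[OF bil]
  and br_minus_left = bilinear_lneg[OF bil]
  and br_minus_right = bilinear_rneg[OF bil]
  and br_zero_left = bilinear_lzero[OF bil]
  and br_zero_right = bilinear_rzero[OF bil]

lemmas br_simps = br_add_left br_add_right br_diff_left br_diff_right br_scale_left br_scale_right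
  br_minus_left br_minus_right br_zero_left br_zero_right

lemma br_anti: "br x y = - br y x"
proof -
  have "br x y + br y x = br (x + y) (x + y)"
    unfolding br_add_left br_add_right by (simp add: br_self add.commute)
  also have "\<dots> = 0" by (rule br_self)
  finally show ?thesis by (simp add: eq_neg_iff_add_eq_0)
qed

lemma jacobi: "br x (br y z) = br (br x y) z + br y (br x z)"
proof -
  have "br x (br y z) + br y (br z x) + br z (br x y) = 0"
    using fin_dim_lie by (simp add: fin_dim_lie_algebra_def)
  then show ?thesis
    using br_anti[of z x] br_anti[of z "br x y"] by (simp add: br_simps algebra_simps eq_neg_iff_add_eq_0)
qed

lemma linear_br: "linear (br x)"
  by (rule linearI) (simp_all add: br_simps)

lemma subspace_br_preimage: "subspace A \<Longrightarrow> subspace {u. br x u \<in> A}"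
  using linear_subspace_vimage[OF linear_br] by (simp add: vimage_def)

lemma lie_idealD:
  assumes "lie_ideal br I" "y \<in> I" shows "br x y \<in> I" "br y x \<in> I"
  using assms br_anti[of y x] subspace_neg by (auto simp: lie_ideal_def)

lemma br_in_bracket_span: "x \<in> A \<Longrightarrow> y \<in> B \<Longrightarrow> br x y \<in> bracket_span br A B"
  unfolding bracket_span_def by (intro span_base) blast

lemma bracket_span_subset:
  "subspace C \<Longrightarrow> (\<And>x y. x \<in> A \<Longrightarrow> y \<in> B \<Longrightarrow> br x y \<in> C) \<Longrightarrow> bracket_span br A B \<subseteq> C"
  unfolding bracket_span_def by (intro span_minimal) auto

lemma subspace_bracket_span: "subspace (bracket_span br A B)"
  by (simp add: bracket_span_def)

text \<open>The span of all iterated brackets \<open>[s\<^sub>1,[s\<^sub>2,\<dots>[s\<^sub>k,v]\<dots>]]\<close> with letters in \<open>S\<close> and arbitrary \<open>v\<close>. That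
  it vanishes for some \<open>k\<close> says that \<open>S\<close> acts on the whole algebra by simultaneously strictly
  triangular operators.\<close>

abbreviation words :: "'a set \<Rightarrow> nat \<Rightarrow> 'a set" where
  "words S k \<equiv> (bracket_span br S ^^ k) UNIV"

lemma subspace_words: "subspace (words S k)"
  by (cases k) (auto simp: subspace_bracket_span)

lemma words_Suc_subset: "words S (Suc k) \<subseteq> words S k"
proof (induction k)
  case (Suc k)
  then have "bracket_span br S (words S (Suc k)) \<subseteq> bracket_span br S (words S k)"
    by (intro bracket_span_mono) auto
  then show ?case by simp
qed simp

text \<open>Since \<open>x\<close> normalizes \<open>S\<close>, it preserves the filtration \<open>words S\<close>. Modulo \<open>words S (Suc j)\<close> the
  elements of \<open>S\<close> annihilate \<open>words S j\<close>, so only the powers of \<open>x\<close> survive there, and the \<open>n\<close>-th one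
  is zero: \<open>n\<close> letters from \<open>T\<close> descend by one step of the filtration of \<open>S\<close>.\<close>

lemma words_extend:
  assumes S: "subspace S" and x: "\<And>s. s \<in> S \<Longrightarrow> br x s \<in> S"
    and nil: "\<And>v. (br x ^^ n) v = 0" and T: "T = {s + c *\<^sub>R x | s c. s \<in> S}"
  shows "words T (n * j) \<subseteq> words S j"
proof (induction j)
  case (Suc j)
  let ?F = "words S j" and ?F' = "words S (Suc j)"
  have F'F: "?F' \<subseteq> ?F" by (rule words_Suc_subset)
  have sF: "subspace ?F" "subspace ?F'" by (rule subspace_words)+
  have SF: "br s u \<in> ?F'" if "s \<in> S" "u \<in> ?F" for s u
    using that by (simp add: br_in_bracket_span)
  have xF: "br x u \<in> words S k" if "u \<in> words S k" for u k
    using that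
  proof (induction k arbitrary: u)
    case (Suc k)
    have "bracket_span br S (words S k) \<subseteq> {u. br x u \<in> words S (Suc k)}"
    proof (rule bracket_span_subset)
      show "subspace {u. br x u \<in> words S (Suc k)}"
        by (rule subspace_br_preimage[OF subspace_words])
      fix s u assume "s \<in> S" "u \<in> words S k"
      then have "br (br x s) u \<in> words S (Suc k)" "br s (br x u) \<in> words S (Suc k)"
        using x Suc.IH by (auto intro: br_in_bracket_span)
      then show "br s u \<in> {u. br x u \<in> words S (Suc k)}"
        using subspace_add[OF subspace_words] by (metis jacobi mem_Collect_eq)
    qed
    then show ?case using Suc.prems by auto
  qed simp
  have pow: "(br x ^^ i) b \<in> ?F" if "b \<in> ?F" for i b
    using that by (induction i) (auto intro: xF)
  have linpow: "linear (br x ^^ i)" for i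
    by (rule linear_funpow[OF linear_br])
  have "(bracket_span br T ^^ i) (words T (n * j)) \<subseteq> {a + (br x ^^ i) b | a b. a \<in> ?F' \<and> b \<in> ?F}" for i
  proof (induction i)
    case 0
    have "0 \<in> ?F'" using sF subspace_0 by blast
    then show ?case using Suc.IH by force
  next
    case (Suc i)
    let ?A = "\<lambda>i. {a + (br x ^^ i) b | a b. a \<in> ?F' \<and> b \<in> ?F}"
    have subA: "subspace (?A i)" for i
    proof -
      have "?A i = {a + b | a b. a \<in> ?F' \<and> b \<in> (br x ^^ i) ` ?F}" by blast
      moreover have "subspace ((br x ^^ i) ` ?F)"
        using linear_subspace_image[OF linpow sF(1)] .
      ultimately show ?thesis using subspace_sums[OF sF(2)] by simp
    qed
    have "bracket_span br T (?A i) \<subseteq> ?A (Suc i)"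
    proof (rule bracket_span_subset[OF subA])
      fix t w assume "t \<in> T" "w \<in> ?A i"
      then obtain s c a b where *: "t = s + c *\<^sub>R x" "s \<in> S" "w = a + (br x ^^ i) b" "a \<in> ?F'" "b \<in> ?F"
        using T by blast
      have "w \<in> ?F" using * pow F'F sF by (auto intro: subspace_add)
      then have "br s w + c *\<^sub>R br x a \<in> ?F'"
        using SF[OF *(2)] xF[OF *(4)] sF by (intro subspace_add subspace_scale)
      moreover have "c *\<^sub>R b \<in> ?F" using * sF by (intro subspace_scale)
      moreover have "br t w = (br s w + c *\<^sub>R br x a) + (br x ^^ Suc i) (c *\<^sub>R b)"
        by (simp add: * br_simps linear_scale[OF linpow] scaleR_add_right)
      ultimately show "br t w \<in> ?A (Suc i)" by blast
    qed
    moreover have "bracket_span br T ((bracket_span br T ^^ i) (words T (n * j))) \<subseteq> bracket_span br T (?A i)"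
      by (intro bracket_span_mono Suc.IH order_refl)
    ultimately show ?case by (simp only: funpow.simps o_apply)
  qed
  from this[of n] have "(bracket_span br T ^^ n) (words T (n * j)) \<subseteq> ?F'"
    by (auto simp: nil)
  then show ?case by (simp add: funpow_add)
qed simp

text \<open>Take a subalgebra \<open>S\<close> of \<open>N\<close> of largest dimension that acts strictly triangularly. If \<open>S \<noteq> N\<close>,
  then, starting in \<open>N\<close> outside \<open>S\<close> and bracketing with \<open>S\<close> for as long as that stays outside, one
  arrives at an element \<open>x\<close> that normalizes \<open>S\<close>, and \<open>S + \<real>x\<close> still acts strictly triangularly.\<close>

theorem engel:
  assumes N: "lie_ideal br N" and nil: "\<And>x. x \<in> N \<Longrightarrow> \<exists>n. \<forall>v. (br x ^^ n) v = 0"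
  obtains m where "words N m \<subseteq> {0}"
proof -
  define Q where "Q S \<longleftrightarrow> subspace S \<and> S \<subseteq> N \<and> (\<forall>s\<in>S. \<forall>t\<in>S. br s t \<in> S) \<and> (\<exists>m. words S m \<subseteq> {0})" for S
  have sN: "subspace N" using N by (simp add: lie_ideal_def)
  have "words {0} 1 \<subseteq> {0}" using bracket_span_subset[of "{0}" "{0}"] by (auto simp: br_simps)
  then have "Q {0}" using subspace_0[OF sN] unfolding Q_def by (auto simp: br_simps intro!: exI[of _ 1])
  moreover obtain B :: "'a set" where "finite B" "span B = UNIV" using fd by (auto simp: fin_dim_def)
  then have "dim S \<le> card B" for S :: "'a set" by (intro dim_le_card) auto
  ultimately obtain S where S: "Q S" and max: "\<And>T. Q T \<Longrightarrow> dim T \<le> dim S"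
    using ex_has_greatest_nat[of Q "{0}" dim "Suc (card B)"] by (auto simp: less_Suc_eq_le)
  then obtain m where sS: "subspace S" "S \<subseteq> N" and m: "words S m \<subseteq> {0}"
    and SS: "\<And>s t. s \<in> S \<Longrightarrow> t \<in> S \<Longrightarrow> br s t \<in> S" by (auto simp: Q_def)
  have "N = S"
  proof (rule ccontr)
    assume "N \<noteq> S"
    then obtain u where u: "u \<in> N" "u \<notin> S" using sS by blast
    have "\<exists>x\<in>N - S. \<forall>s\<in>S. br s x \<in> S"
    proof (rule ccontr)
      assume *: "\<not> ?thesis"
      have "\<exists>x\<in>N - S. x \<in> words S k" for k
      proof (induction k)
        case 0 then show ?case using u by auto
      next
        case (Suc k)
        then obtain x where x: "x \<in> N - S" "x \<in> words S k" by blast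
        then obtain s where "s \<in> S" "br s x \<notin> S" using * by blast
        moreover from this x have "br s x \<in> N" "br s x \<in> words S (Suc k)"
          using lie_idealD[OF N] by (auto intro: br_in_bracket_span)
        ultimately show ?case by blast
      qed
      then show False using m subspace_0[OF sS(1)] by blast
    qed
    then obtain x where x: "x \<in> N" "x \<notin> S" "\<And>s. s \<in> S \<Longrightarrow> br s x \<in> S" by blast
    then have x': "br x s \<in> S" if "s \<in> S" for s using br_anti[of x s] subspace_neg[OF sS(1)] that by simp
    obtain n where n: "\<And>v. (br x ^^ n) v = 0" using nil x(1) by blast
    define T where "T = {s + c *\<^sub>R x | s c. s \<in> S}"
    have "T = {s + y | s y. s \<in> S \<and> y \<in> span {x}}" by (auto simp: T_def span_singleton)
    then have sT: "subspace T" using subspace_sums[OF sS(1) subspace_span] by simp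
    have ST: "S \<subseteq> T" unfolding T_def by (force intro: exI[of _ "0::real"])
    have xT: "x \<in> T" unfolding T_def using subspace_0[OF sS(1)] by (force intro: exI[of _ "1::real"])
    have TN: "T \<subseteq> N" using sS x(1) sN by (auto simp: T_def intro!: subspace_add subspace_scale)
    have TT: "br s t \<in> T" if s: "s \<in> T" and t: "t \<in> T" for s t
    proof -
      obtain a b c d where *: "s = a + c *\<^sub>R x" "t = b + d *\<^sub>R x" "a \<in> S" "b \<in> S"
        using s t unfolding T_def by blast
      have "br s t = br a b + d *\<^sub>R br a x + c *\<^sub>R br x b" by (simp add: * br_simps br_self)
      also have "\<dots> \<in> S" using * SS x(3) x' sS(1) by (intro subspace_add subspace_scale)
      finally show ?thesis using ST by blast
    qed
    have "words T (n * m) \<subseteq> {0}" using words_extend[OF sS(1) x' n T_def, of m] m by blast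
    then have "\<exists>m. words T m \<subseteq> {0}" by (rule exI)
    then have "Q T" unfolding Q_def by (intro conjI ballI sT TN TT)
    then show False
      using max[of T] dim_less_of_subspace[OF fd sS(1) ST xT x(2)] by simp
  qed
  then show ?thesis using m that by blast
qed

lemma derived_series_subset_words:
  assumes N: "lie_ideal br N"
  shows "derived_series br N k \<subseteq> words N k"
proof (induction k)
  case (Suc k)
  have sN: "subspace N" using N by (simp add: lie_ideal_def)
  have "derived_series br N k \<subseteq> N" for k
  proof (induction k)
    case (Suc k)
    show ?case unfolding derived_series.simps
      by (rule bracket_span_subset[OF sN]) (use Suc lie_idealD[OF N] in blast)
  qed simp
  then show ?case using bracket_span_mono[OF _ Suc] by simp
qed simp

lemma lie_solvable_if_ad_nilpotent:
  assumes N: "lie_ideal br N" and nil: "\<And>x. x \<in> N \<Longrightarrow> \<exists>n. \<forall>v. (br x ^^ n) v = 0"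
  shows "lie_solvable br N"
proof -
  obtain m where "words N m \<subseteq> {0}" using engel[OF assms] .
  then have "derived_series br N m \<subseteq> {0}" using derived_series_subset_words[OF N] by blast
  moreover have "subspace (derived_series br N m)"
    using N by (intro derived_series_subspace) (simp add: lie_ideal_def)
  ultimately show ?thesis unfolding lie_solvable_def using subspace_0 by blast
qed

section \<open>The Killing form and Cartan's criterion\<close>

definition killing :: "'a \<Rightarrow> 'a \<Rightarrow> real" where
  "killing x y = lin_trace (\<lambda>v. br x (br y v))"

lemma killing_commute: "killing x y = killing y x"
  unfolding killing_def by (rule lin_trace_commute[OF fd linear_br linear_br])

lemma killing_add_left: "killing (x + y) z = killing x z + killing y z"
  by (simp add: killing_def br_simps lin_trace_add)

lemma killing_scale_left: "killing (c *\<^sub>R x) z = c * killing x z"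
  by (simp add: killing_def br_simps lin_trace_scale)

lemma killing_add_right: "killing z (x + y) = killing z x + killing z y"
  by (simp add: killing_commute[of z] killing_add_left)

lemma killing_scale_right: "killing z (c *\<^sub>R x) = c * killing z x"
  by (simp add: killing_commute[of z] killing_scale_left)

lemma killing_zero: "killing 0 z = 0" "killing z 0 = 0"
  using killing_scale_left[of 0 0 z] killing_scale_right[of z 0 0] by simp_all

lemma subspace_killing: "subspace {x. killing x z = 0}" "subspace {x. killing z x = 0}"
  by (auto simp: subspace_def killing_add_left killing_scale_left killing_add_right
      killing_scale_right killing_zero)

lemma br_br_left: "br (br x y) z = br x (br y z) - br y (br x z)"
  using jacobi[of x y z] by simp

lemma killing_invariant: "killing (br x y) z = killing x (br y z)"
proof -
  have lin: "linear (\<lambda>v. br x (br z v))" by (rule linearI) (simp_all add: br_simps)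
  have "killing (br x y) z = lin_trace (\<lambda>v. br x (br y (br z v))) - lin_trace (\<lambda>v. br y (br x (br z v)))"
    by (simp add: killing_def br_br_left lin_trace_diff)
  also have "lin_trace (\<lambda>v. br y (br x (br z v))) = lin_trace (\<lambda>v. br x (br z (br y v)))"
    by (rule lin_trace_commute[OF fd linear_br lin])
  finally show ?thesis by (simp add: killing_def br_br_left br_diff_right lin_trace_diff)
qed

text \<open>Moving \<open>Y\<close> around the trace replaces the pairing of \<open>[a,b]\<close> with \<open>Y\<close> by the commutator of \<open>ad b\<close>
  with \<open>Y\<close>, which for a derivation is the inner operator \<open>- ad (Y b)\<close>.\<close>

lemma trace_br_derivation:
  assumes Y: "linear Y" and der: "\<And>a b. Y (br a b) = br (Y a) b + br a (Y b)"
  shows "lin_trace (\<lambda>v. br (br a b) (Y v)) = - killing a (Y b)"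
proof -
  have lin: "linear (\<lambda>v. br a (Y v))" using linear_compose[OF Y linear_br] by (simp add: o_def)
  have "lin_trace (\<lambda>v. br (br a b) (Y v)) =
      lin_trace (\<lambda>v. br a (br b (Y v))) - lin_trace (\<lambda>v. br b (br a (Y v)))"
    by (simp add: br_br_left lin_trace_diff)
  also have "lin_trace (\<lambda>v. br b (br a (Y v))) = lin_trace (\<lambda>v. br a (Y (br b v)))"
    by (rule lin_trace_commute[OF fd linear_br lin])
  also have "\<dots> = killing a (Y b) + lin_trace (\<lambda>v. br a (br b (Y v)))"
    by (simp add: der br_simps lin_trace_add killing_def)
  finally show ?thesis by simp
qed

abbreviation derived_algebra :: "'a set" where
  "derived_algebra \<equiv> bracket_span br UNIV UNIV"

text \<open>It suffices that \<open>N = [J,G]\<close> consists of ad-nilpotent elements, by Engel's theorem and because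
  \<open>[J,J] \<subseteq> N\<close>. For \<open>x \<in> N\<close> let \<open>Y\<close> be the conjugate semisimple part of \<open>ad x\<close>. It maps into
  \<open>[G,G]\<close>, so the trace of \<open>ad [a,b] \<circ> Y\<close> with \<open>a \<in> J\<close> is a Killing product of \<open>a\<close> with an element of
  \<open>[G,G]\<close>, which is zero.\<close>

theorem cartan_solvability:
  assumes J: "lie_ideal br J"
    and orth: "\<And>x y. x \<in> J \<Longrightarrow> y \<in> derived_algebra \<Longrightarrow> killing x y = 0"
  shows "lie_solvable br J"
proof -
  have sJ: "subspace J" using J by (simp add: lie_ideal_def)
  define N where "N = bracket_span br J UNIV"
  have sN: "subspace N" unfolding N_def by (rule subspace_bracket_span)
  have "N \<subseteq> {y. br z y \<in> N}" for z
    unfolding N_def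
  proof (rule bracket_span_subset)
    show "subspace {y. br z y \<in> bracket_span br J UNIV}"
      by (rule subspace_br_preimage[OF subspace_bracket_span])
    fix x y assume "x \<in> J"
    then have "br (br z x) y \<in> bracket_span br J UNIV" "br x (br z y) \<in> bracket_span br J UNIV"
      using lie_idealD[OF J] by (auto intro: br_in_bracket_span)
    then show "br x y \<in> {y. br z y \<in> bracket_span br J UNIV}"
      using subspace_add[OF subspace_bracket_span] by (metis jacobi mem_Collect_eq)
  qed
  then have idN: "lie_ideal br N" using sN by (auto simp: lie_ideal_def)
  have "\<exists>n. \<forall>v. (br x ^^ n) v = 0" if x: "x \<in> N" for x
  proof -
    obtain Y where Y: "linear Y" "\<And>u. Y u \<in> range (br x)"
      "\<And>a b. Y (br a b) = br (Y a) b + br a (Y b)"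
      and nil: "lin_trace (\<lambda>v. br x (Y v)) = 0 \<longrightarrow> (\<exists>n. \<forall>a. (br x ^^ n) a = 0)"
      using conjugate_semisimple_part[where X = "br x" and br = br, OF fd linear_br bil jacobi]
      by blast
    have "Y b \<in> derived_algebra" for b
      using Y(2)[of b] br_in_bracket_span by auto
    then have "N \<subseteq> {x. lin_trace (\<lambda>v. br x (Y v)) = 0}"
      unfolding N_def
      by (intro bracket_span_subset)
        (auto simp: subspace_def br_simps lin_trace_add lin_trace_scale lin_trace_0
          trace_br_derivation[OF Y(1,3)] orth)
    then show ?thesis using nil x by blast
  qed
  then obtain n where n: "derived_series br N n = {0}"
    using lie_solvable_if_ad_nilpotent[OF idN] by (auto simp: lie_solvable_def)
  have "derived_series br J 1 \<subseteq> N" unfolding N_def by (simp add: bracket_span_mono)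
  then have "derived_series br J (1 + n) \<subseteq> {0}"
    unfolding derived_series_add using derived_series_mono n by blast
  moreover have "subspace (derived_series br J (1 + n))" by (rule derived_series_subspace[OF sJ])
  ultimately show ?thesis unfolding lie_solvable_def using subspace_0 by blast
qed

text \<open>By invariance of the Killing form, the elements that are Killing-orthogonal to \<open>[G,G]\<close> form an
  ideal, to which the criterion applies.\<close>

corollary killing_orthogonal_derived_in_radical:
  assumes "\<And>y. y \<in> derived_algebra \<Longrightarrow> killing x y = 0"
  shows "x \<in> lie_radical br"
proof -
  define J where "J = {x. \<forall>y\<in>derived_algebra. killing x y = 0}"
  have "lie_ideal br J"
    unfolding lie_ideal_def
  proof (intro conjI allI ballI)
    show "subspace J"
      by (auto simp: J_def subspace_def killing_add_left killing_scale_left killing_zero)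
    fix z x assume "x \<in> J"
    then show "br z x \<in> J"
      unfolding J_def by (auto simp: br_anti[of z x] killing_invariant br_in_bracket_span
          killing_scale_left[of "-1", simplified])
  qed
  moreover from this have "lie_solvable br J" by (rule cartan_solvability) (simp add: J_def)
  ultimately have "J \<subseteq> lie_radical br" by (rule lie_radical_greatest(3)[OF fin_dim_lie])
  then show ?thesis using assms by (auto simp: J_def)
qed

end

section \<open>Symplectic symmetric triples and their radical\<close>

text \<open>Induction on \<open>B\<close>: if \<open>g b\<close> does not vanish at some \<open>x\<^sub>0\<close> in the common kernel of the other
  functionals, subtracting from \<open>f\<close> the multiple of \<open>g b\<close> that agrees with \<open>f\<close> at \<open>x\<^sub>0\<close> leaves a
  functional that vanishes on the larger kernel without \<open>b\<close>. Linearity of \<open>f\<close> is asked on \<open>P\<close> only, to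
  suit a symplectic form whose values are meaningful just on \<open>P \<times> P\<close>.\<close>

lemma functional_combination:
  fixes f :: "'a::real_vector \<Rightarrow> real" and g :: "'b \<Rightarrow> 'a \<Rightarrow> real"
  assumes P: "subspace P" and "finite B"
    and f: "\<And>x y. x \<in> P \<Longrightarrow> y \<in> P \<Longrightarrow> f (x + y) = f x + f y" "\<And>c x. x \<in> P \<Longrightarrow> f (c *\<^sub>R x) = c * f x"
    and g: "\<And>b. linear (g b)"
    and ker: "\<And>x. x \<in> P \<Longrightarrow> (\<And>b. b \<in> B \<Longrightarrow> g b x = 0) \<Longrightarrow> f x = 0"
  obtains c where "\<And>x. x \<in> P \<Longrightarrow> f x = (\<Sum>b\<in>B. c b * g b x)"
proof -
  have "\<exists>c. \<forall>x\<in>P. f x = (\<Sum>b\<in>B. c b * g b x)"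
    using assms(2) f ker
  proof (induction B arbitrary: f rule: finite_induct)
    case empty
    then show ?case by auto
  next
    case (insert b B)
    note g_simps = linear_add[OF g] linear_diff[OF g] linear_scale[OF g]
    show ?case
    proof (cases "\<exists>x0\<in>P. (\<forall>b'\<in>B. g b' x0 = 0) \<and> g b x0 \<noteq> 0")
      case False
      then have "f x = 0" if "x \<in> P" "\<And>b'. b' \<in> B \<Longrightarrow> g b' x = 0" for x
        using insert.prems(3)[OF that(1)] that by (metis insert_iff)
      then have "\<exists>c. \<forall>x\<in>P. f x = (\<Sum>b\<in>B. c b * g b x)"
        using insert.prems by (intro insert.IH) auto
      then obtain c where c: "\<And>x. x \<in> P \<Longrightarrow> f x = (\<Sum>b\<in>B. c b * g b x)" by blast
      have "(\<Sum>b'\<in>B. c b' * g b' x) = (\<Sum>b'\<in>B. (c(b := 0)) b' * g b' x)" for x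
        using insert.hyps by (intro sum.cong) auto
      then show ?thesis using c insert.hyps by (intro exI[of _ "c(b := 0)"]) simp
    next
      case True
      then obtain x0 where x0: "x0 \<in> P" "\<And>b'. b' \<in> B \<Longrightarrow> g b' x0 = 0" "g b x0 \<noteq> 0" by blast
      define a where "a = f x0 / g b x0"
      define f' where "f' x = f x - a * g b x" for x
      have "f' x = 0" if x: "x \<in> P" "\<And>b'. b' \<in> B \<Longrightarrow> g b' x = 0" for x
      proof -
        define t where "t = - (g b x / g b x0)"
        have "x + t *\<^sub>R x0 \<in> P" using x x0 P by (intro subspace_add subspace_scale)
        moreover have "g b' (x + t *\<^sub>R x0) = 0" if "b' \<in> insert b B" for b'
          using that x x0 by (auto simp: g_simps t_def)
        ultimately have "f (x + t *\<^sub>R x0) = 0" using insert.prems(3) by blast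
        moreover have "f (x + t *\<^sub>R x0) = f x + t * f x0"
          using insert.prems(1,2) x(1) x0(1) P by (simp add: subspace_scale)
        ultimately show ?thesis by (simp add: f'_def a_def t_def)
      qed
      moreover have "f' (x + y) = f' x + f' y" if "x \<in> P" "y \<in> P" for x y
        using that insert.prems(1) by (simp add: f'_def g_simps algebra_simps)
      moreover have "f' (r *\<^sub>R x) = r * f' x" if "x \<in> P" for r x
        using that insert.prems(2) by (simp add: f'_def g_simps algebra_simps)
      ultimately have "\<exists>c. \<forall>x\<in>P. f' x = (\<Sum>b\<in>B. c b * g b x)" by (intro insert.IH) auto
      then obtain c where c: "\<And>x. x \<in> P \<Longrightarrow> f' x = (\<Sum>b\<in>B. c b * g b x)" by blast
      have "(\<Sum>b'\<in>B. c b' * g b' x) = (\<Sum>b'\<in>B. (c(b := a)) b' * g b' x)" for x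
        using insert.hyps by (intro sum.cong) auto
      moreover have "f x = f' x + a * g b x" for x by (simp add: f'_def)
      ultimately show ?thesis using c insert.hyps by (intro exI[of _ "c(b := a)"]) simp
    qed
  qed
  then show ?thesis using that by blast
qed

locale symplectic_triple =
  fixes br :: "'a::real_vector \<Rightarrow> 'a \<Rightarrow> 'a" and \<sigma> :: "'a \<Rightarrow> 'a" and \<Omega> :: "'a \<Rightarrow> 'a \<Rightarrow> real"
  assumes triple: "symplectic_symmetric_triple br \<sigma> \<Omega>"
begin

sublocale lie_algebra br
  using triple by unfold_locales (simp add: symplectic_symmetric_triple_def)

abbreviation K where "K \<equiv> K_part \<sigma>"
abbreviation P where "P \<equiv> P_part \<sigma>"
abbreviation R where "R \<equiv> lie_radical br"

lemma involutive: "involutive_automorphism br \<sigma>"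
  using triple by (simp add: symplectic_symmetric_triple_def)

lemma linear_sigma: "linear \<sigma>"
  using involutive by (simp add: involutive_automorphism_def)

lemma sigma_br: "\<sigma> (br x y) = br (\<sigma> x) (\<sigma> y)"
  using involutive by (simp add: involutive_automorphism_def)

lemma sigma_sigma: "\<sigma> (\<sigma> x) = x"
  using involutive by (simp add: involutive_automorphism_def fun_eq_iff)

lemmas sigma_simps = linear_add[OF linear_sigma] linear_diff[OF linear_sigma]
  linear_scale[OF linear_sigma] linear_0[OF linear_sigma] linear_neg[OF linear_sigma]

lemma subspace_P: "subspace P"
  by (auto simp: subspace_def P_part_def sigma_simps)

lemma br_KK: "k \<in> K \<Longrightarrow> k' \<in> K \<Longrightarrow> br k k' \<in> K"
  and br_KP: "k \<in> K \<Longrightarrow> x \<in> P \<Longrightarrow> br k x \<in> P"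
  and br_PP: "x \<in> P \<Longrightarrow> y \<in> P \<Longrightarrow> br x y \<in> K"
  by (simp_all add: K_part_def P_part_def sigma_br br_simps)

lemma canonical_decomposition:
  assumes "subspace I" "\<And>x. x \<in> I \<Longrightarrow> \<sigma> x \<in> I" "x \<in> I"
  obtains k p where "k \<in> K \<inter> I" "p \<in> P \<inter> I" "x = k + p"
proof
  show "(1/2) *\<^sub>R (x + \<sigma> x) \<in> K \<inter> I" "(1/2) *\<^sub>R (x - \<sigma> x) \<in> P \<inter> I"
    using assms by (auto simp: K_part_def P_part_def sigma_simps sigma_sigma add.commute
        subspace_scale subspace_add subspace_diff simp flip: scaleR_minus_right)
  show "x = (1/2) *\<^sub>R (x + \<sigma> x) + (1/2) *\<^sub>R (x - \<sigma> x)"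
    by (simp add: algebra_simps flip: scaleR_add_left)
qed

lemma decompose:
  obtains k p where "k \<in> K" "p \<in> P" "x = k + p"
  using canonical_decomposition[of UNIV x] by auto

lemma K_eq: "bracket_span br P P = K"
  using triple by (simp add: symplectic_symmetric_triple_def)

lemma faithful: "k \<in> K \<Longrightarrow> (\<And>x. x \<in> P \<Longrightarrow> br k x = 0) \<Longrightarrow> k = 0"
  using triple by (simp add: symplectic_symmetric_triple_def)

lemma omega_form: "symplectic_form_on P \<Omega>"
  using triple by (simp add: symplectic_symmetric_triple_def)

lemma omega_add:
  assumes "x \<in> P" "y \<in> P" "z \<in> P"
  shows "\<Omega> (x + y) z = \<Omega> x z + \<Omega> y z" "\<Omega> z (x + y) = \<Omega> z x + \<Omega> z y"
  using omega_form assms by (auto simp: symplectic_form_on_def)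

lemma omega_scale:
  assumes "x \<in> P" "y \<in> P"
  shows "\<Omega> (c *\<^sub>R x) y = c * \<Omega> x y" "\<Omega> x (c *\<^sub>R y) = c * \<Omega> x y"
  using omega_form assms by (auto simp: symplectic_form_on_def)

lemma omega_self: "x \<in> P \<Longrightarrow> \<Omega> x x = 0"
  using omega_form by (simp add: symplectic_form_on_def)

lemma omega_anti:
  assumes "x \<in> P" "y \<in> P" shows "\<Omega> x y = - \<Omega> y x"
  using omega_self[of "x + y"] omega_self[of x] omega_self[of y] assms
  by (simp add: omega_add subspace_add[OF subspace_P])

lemma omega_nondegenerate: "x \<in> P \<Longrightarrow> (\<And>y. y \<in> P \<Longrightarrow> \<Omega> x y = 0) \<Longrightarrow> x = 0"
  using omega_form by (simp add: symplectic_form_on_def)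

lemma omega_invariant: "k \<in> K \<Longrightarrow> x \<in> P \<Longrightarrow> y \<in> P \<Longrightarrow> \<Omega> (br k x) y + \<Omega> x (br k y) = 0"
  using triple by (simp add: symplectic_symmetric_triple_def)

lemma ideal_R: "lie_ideal br R" and solvable_R: "lie_solvable br R"
  using lie_radical_greatest[OF fin_dim_lie] by auto

lemma subspace_R: "subspace R"
  using ideal_R by (simp add: lie_ideal_def)

lemma derived_series_sigma: "derived_series br (\<sigma> ` A) n = \<sigma> ` derived_series br A n"
proof (induction n)
  case (Suc n)
  have "bracket_span br (\<sigma> ` B) (\<sigma> ` B) = \<sigma> ` bracket_span br B B" for B
  proof -
    have "{br a b |a b. a \<in> \<sigma> ` B \<and> b \<in> \<sigma> ` B} = {\<sigma> (br a b) |a b. a \<in> B \<and> b \<in> B}"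
      unfolding sigma_br by blast
    also have "\<dots> = \<sigma> ` {br a b |a b. a \<in> B \<and> b \<in> B}" by blast
    finally have "{br a b |a b. a \<in> \<sigma> ` B \<and> b \<in> \<sigma> ` B} = \<sigma> ` {br a b |a b. a \<in> B \<and> b \<in> B}" .
    then show ?thesis by (simp add: bracket_span_def linear_span_image[OF linear_sigma])
  qed
  then show ?case using Suc by simp
qed simp

lemma sigma_R: "x \<in> R \<Longrightarrow> \<sigma> x \<in> R"
proof -
  have "br z (\<sigma> y) \<in> \<sigma> ` R" if "y \<in> R" for y z
    using lie_idealD(1)[OF ideal_R that, of "\<sigma> z"] sigma_br[of "\<sigma> z" y] sigma_sigma by (metis imageI)
  then have "lie_ideal br (\<sigma> ` R)"
    using linear_subspace_image[OF linear_sigma subspace_R] by (auto simp: lie_ideal_def)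
  moreover obtain n where "derived_series br R n = {0}" using solvable_R by (auto simp: lie_solvable_def)
  then have "derived_series br (\<sigma> ` R) n = {0}" by (simp add: derived_series_sigma sigma_simps)
  then have "lie_solvable br (\<sigma> ` R)" by (auto simp: lie_solvable_def)
  ultimately have "\<sigma> ` R \<subseteq> R" by (rule lie_radical_greatest(3)[OF fin_dim_lie])
  then show "x \<in> R \<Longrightarrow> \<sigma> x \<in> R" by blast
qed

text \<open>The Killing form is invariant under the involution, which acts with opposite signs on \<open>K\<close> and \<open>P\<close>.\<close>

lemma killing_K_P:
  assumes "k \<in> K" "x \<in> P" shows "killing x k = 0"
proof -
  have lin: "linear (\<lambda>u. br x (br k (\<sigma> u)))" for x k
    by (rule linearI) (simp_all add: sigma_simps br_simps)
  have "killing (\<sigma> x) (\<sigma> k) = lin_trace (\<lambda>u. \<sigma> (br x (br k (\<sigma> u))))"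
    by (simp add: killing_def sigma_br sigma_sigma)
  also have "\<dots> = lin_trace (\<lambda>u. br x (br k (\<sigma> (\<sigma> u))))"
    by (rule lin_trace_commute[OF fd linear_sigma lin])
  also have "\<dots> = killing x k" by (simp add: killing_def sigma_sigma)
  finally have "killing ((-1) *\<^sub>R x) k = killing x k" using assms by (simp add: K_part_def P_part_def)
  then show ?thesis by (simp only: killing_scale_left)
qed

text \<open>Modulo the radical, \<open>P\<close> is spanned by \<open>p\<close>, so \<open>K = [P,P]\<close> vanishes modulo the radical because
  \<open>[p,p] = 0\<close>.\<close>

lemma solvable_if_P_spanned_mod_radical_by_one:
  assumes p: "\<And>x. x \<in> P \<Longrightarrow> \<exists>c. x - c *\<^sub>R p \<in> R"
  shows "lie_solvable br (UNIV :: 'a set)"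
proof -
  have PP: "br x y \<in> R" if "x \<in> P" "y \<in> P" for x y
  proof -
    obtain c d where "x - c *\<^sub>R p \<in> R" "y - d *\<^sub>R p \<in> R" using p \<open>x \<in> P\<close> \<open>y \<in> P\<close> by blast
    then have "br (x - c *\<^sub>R p) y + c *\<^sub>R br p (y - d *\<^sub>R p) \<in> R"
      using lie_idealD[OF ideal_R] subspace_R by (intro subspace_add subspace_scale)
    then show ?thesis by (simp add: br_simps br_self)
  qed
  then have KR: "K \<subseteq> R" unfolding K_eq[symmetric] by (rule bracket_span_subset[OF subspace_R])
  have "derived_algebra \<subseteq> R"
  proof (rule bracket_span_subset[OF subspace_R])
    fix x y :: 'a
    obtain k q where x: "k \<in> K" "q \<in> P" "x = k + q" by (rule decompose)
    obtain k' q' where y: "k' \<in> K" "q' \<in> P" "y = k' + q'" by (rule decompose)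
    have "br k y + (br q k' + br q q') \<in> R"
      using x y KR PP lie_idealD[OF ideal_R] subspace_R by (intro subspace_add) blast+
    moreover have "br x y = br k y + (br q k' + br q q')" by (simp add: x y br_simps algebra_simps)
    ultimately show "br x y \<in> R" by simp
  qed
  then have "derived_series br (UNIV :: 'a set) 1 \<subseteq> R" by simp
  moreover obtain n where n: "derived_series br R n = {0}" using solvable_R by (auto simp: lie_solvable_def)
  ultimately have "derived_series br UNIV (1 + n) \<subseteq> {0}"
    unfolding derived_series_add using derived_series_mono n by blast
  moreover have "subspace (derived_series br (UNIV :: 'a set) (1 + n))"
    by (rule derived_series_subspace[OF subspace_UNIV])
  ultimately show ?thesis unfolding lie_solvable_def using subspace_0 by blast
qed

text \<open>If \<open>k \<in> K \<inter> R\<close> and \<open>y \<in> P\<close>, then \<open>[k,y]\<close> lies in \<open>P \<inter> R\<close>, so \<open>k\<close> acts trivially on \<open>P\<close>.\<close>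

lemma radical_zero_if_P_radical_zero:
  assumes "P \<inter> R \<subseteq> {0}" shows "R = {0}"
proof -
  have "x = 0" if x: "x \<in> R" for x
  proof -
    obtain k p where kp: "k \<in> K \<inter> R" "p \<in> P \<inter> R" "x = k + p"
      using canonical_decomposition[OF subspace_R sigma_R x] by blast
    have "br k y = 0" if "y \<in> P" for y
      using kp(1) that br_KP lie_idealD(2)[OF ideal_R] assms by blast
    then have "k = 0" using faithful kp(1) by blast
    then show ?thesis using kp assms by auto
  qed
  then show ?thesis using subspace_0[OF subspace_R] by blast
qed

text \<open>
  Write \<open>l\<close> for the character of \<open>K\<close> on \<open>v\<close> and \<open>\<kappa> y = c(\<kappa>) \<Omega>(v,y) v\<close> for \<open>\<kappa> \<in> K \<inter> R\<close>. Since \<open>\<Omega>\<close> is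
  invariant, \<open>K\<close> acts on \<open>\<Omega>(v,-)\<close> by \<open>- l\<close>, hence on \<open>\<kappa>\<close> by \<open>2 l\<close>. For \<open>k = [x,y]\<close>, expanding
  \<open>[[x,y],\<kappa>]\<close> by the Jacobi identity instead gives \<open>- l\<close>. So \<open>3 l(k) c(\<kappa>) = 0\<close>; and if all \<open>c(\<kappa>)\<close>
  vanish, then the Jacobi identity for \<open>[[x,y],v]\<close> yields \<open>l(k) = 0\<close> as well. Once \<open>l = 0\<close>, \<open>K\<close>
  commutes with \<open>v\<close> and with \<open>K \<inter> R\<close>, so \<open>ad v \<circ> ad x = 0\<close> for \<open>x \<in> P\<close>, and the
  vector \<open>z\<close> representing \<open>\<Omega>(v,-)\<close> through the Killing form leads to the contradiction.
\<close>

theorem P_radical_not_line: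
  assumes v: "v \<in> P \<inter> R" "v \<noteq> 0" and one: "\<And>x. x \<in> P \<inter> R \<Longrightarrow> \<exists>c. x = c *\<^sub>R v"
  shows False
proof -
  have vP: "v \<in> P" and vR: "v \<in> R" using v by auto
  obtain y0 where y0: "y0 \<in> P" "\<Omega> v y0 \<noteq> 0" using omega_nondegenerate vP v(2) by blast
  have PKR: "br v y \<in> K \<inter> R" if "y \<in> P" for y
    using that br_PP vP lie_idealD(2)[OF ideal_R vR] by blast
  have "\<exists>c. \<forall>y\<in>P. br \<kappa> y = (c * \<Omega> v y) *\<^sub>R v" if \<kappa>: "\<kappa> \<in> K \<inter> R" for \<kappa>
  proof -
    have "\<exists>a. br \<kappa> y = a *\<^sub>R v" if "y \<in> P" for y
      using one br_KP lie_idealD(2)[OF ideal_R] \<kappa> that by blast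
    then obtain a where a: "\<And>y. y \<in> P \<Longrightarrow> br \<kappa> y = a y *\<^sub>R v" by metis
    have "a y = (a y0 / \<Omega> v y0) * \<Omega> v y" if y: "y \<in> P" for y
    proof -
      have "a y * \<Omega> v y0 + a y0 * \<Omega> y v = 0"
        using omega_invariant[of \<kappa> y y0] \<kappa> y y0 vP by (simp add: a omega_scale)
      then show ?thesis using omega_anti[OF y vP] y0(2) by (simp add: field_simps)
    qed
    then show ?thesis using a by metis
  qed
  then obtain c where c: "\<And>\<kappa> y. \<kappa> \<in> K \<inter> R \<Longrightarrow> y \<in> P \<Longrightarrow> br \<kappa> y = (c \<kappa> * \<Omega> v y) *\<^sub>R v" by metis
  have "\<exists>l. br k v = l *\<^sub>R v" if "k \<in> K" for k
    using one[of "br k v"] br_KP[OF that vP] lie_idealD(1)[OF ideal_R vR] by blast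
  then obtain l where l: "\<And>k. k \<in> K \<Longrightarrow> br k v = l k *\<^sub>R v" by metis
  have lw: "\<Omega> v (br k y) = - l k * \<Omega> v y" if "k \<in> K" "y \<in> P" for k y
    using omega_invariant[OF that(1) vP that(2)] that vP by (simp add: l omega_scale)

  have l_PP: "l (br x y) = c (br v y) * \<Omega> v x - c (br v x) * \<Omega> v y" if x: "x \<in> P" and y: "y \<in> P" for x y
  proof -
    have "l (br x y) *\<^sub>R v = br (br x y) v" using l br_PP x y by simp
    also have "\<dots> = br (br v y) x - br (br v x) y"
      using br_anti[of "br v y" x] br_anti[of "br v x" y] br_anti[of v x] br_anti[of v y]
      by (simp add: br_br_left[of x y v] br_simps)
    also have "\<dots> = (c (br v y) * \<Omega> v x - c (br v x) * \<Omega> v y) *\<^sub>R v"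
      by (simp add: c[OF PKR[OF y] x] c[OF PKR[OF x] y] scaleR_diff_left)
    finally show ?thesis using v(2) by simp
  qed
  have l_zero: "l (br x y) = 0" if x: "x \<in> P" and y: "y \<in> P" for x y
  proof (rule ccontr)
    assume l0: "l (br x y) \<noteq> 0"
    have "c \<kappa> = 0" if \<kappa>: "\<kappa> \<in> K \<inter> R" for \<kappa>
    proof -
      let ?k = "br x y"
      have k: "?k \<in> K" using br_PP x y by blast
      have "br (br ?k \<kappa>) y0 = br ?k (br \<kappa> y0) - br \<kappa> (br ?k y0)" by (rule br_br_left)
      also have "\<dots> = (l ?k * c \<kappa> * \<Omega> v y0) *\<^sub>R v + (l ?k * c \<kappa> * \<Omega> v y0) *\<^sub>R v"
        by (simp add: c[OF \<kappa> y0(1)] c[OF \<kappa> br_KP[OF k y0(1)]] l[OF k] lw[OF k y0(1)]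
            br_scale_right algebra_simps)
      also have "\<dots> = (l ?k * c \<kappa> * \<Omega> v y0 + l ?k * c \<kappa> * \<Omega> v y0) *\<^sub>R v"
        by (rule scaleR_add_left[symmetric])
      finally have 1: "br (br ?k \<kappa>) y0 = (l ?k * c \<kappa> * \<Omega> v y0 + l ?k * c \<kappa> * \<Omega> v y0) *\<^sub>R v" .
      have "br ?k \<kappa> = br x (br y \<kappa>) - br y (br x \<kappa>)" by (rule br_br_left)
      also have "\<dots> = br y (br \<kappa> x) - br x (br \<kappa> y)"
        by (simp add: br_anti[of y \<kappa>] br_anti[of x \<kappa>] br_minus_right)
      also have "\<dots> = (c \<kappa> * \<Omega> v y) *\<^sub>R br v x - (c \<kappa> * \<Omega> v x) *\<^sub>R br v y"
        by (simp add: c[OF \<kappa> x] c[OF \<kappa> y] br_scale_right br_anti[of x v] br_anti[of y v])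
      finally have "br (br ?k \<kappa>) y0 =
          (c \<kappa> * \<Omega> v y) *\<^sub>R br (br v x) y0 - (c \<kappa> * \<Omega> v x) *\<^sub>R br (br v y) y0"
        by (simp add: br_diff_left br_scale_left)
      also have "\<dots> = (- l ?k * c \<kappa> * \<Omega> v y0) *\<^sub>R v"
        by (simp add: c[OF PKR[OF x] y0(1)] c[OF PKR[OF y] y0(1)] l_PP[OF x y] algebra_simps)
      finally have "l ?k * c \<kappa> * \<Omega> v y0 + l ?k * c \<kappa> * \<Omega> v y0 = - l ?k * c \<kappa> * \<Omega> v y0"
        unfolding 1 scaleR_cancel_right using v(2) by blast
      then have "3 * (l ?k * c \<kappa> * \<Omega> v y0) = 0" by linarith
      then show ?thesis using l0 y0(2) by simp
    qed
    then have "l (br x y) = 0" using l_PP[OF x y] PKR x y by simp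
    then show False using l0 by simp
  qed
  have "K \<subseteq> {k. br k v = 0}"
    unfolding K_eq[symmetric]
  proof (rule bracket_span_subset)
    show "subspace {k. br k v = 0}" by (auto simp: subspace_def br_simps)
  qed (use l l_zero br_PP in simp)
  then have Kv: "br k v = 0" if "k \<in> K" for k using that by blast
  then have vK: "br v k = 0" if "k \<in> K" for k using br_anti[of v k] that by simp
  have w_KP: "\<Omega> v (br k y) = 0" if "k \<in> K" "y \<in> P" for k y
  proof -
    have "\<Omega> 0 y = 0" using omega_scale(1)[OF vP that(2), of 0] by simp
    then show ?thesis using omega_invariant[OF that(1) vP that(2)] by (simp add: Kv that)
  qed
  have KKR: "br k \<kappa> = 0" if k: "k \<in> K" and \<kappa>: "\<kappa> \<in> K \<inter> R" for k \<kappa>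
  proof (rule faithful)
    show "br k \<kappa> \<in> K" using k \<kappa> br_KK by blast
    show "br (br k \<kappa>) y = 0" if "y \<in> P" for y
      by (simp add: br_br_left c[OF \<kappa> that] c[OF \<kappa> br_KP[OF k that]] w_KP[OF k that]
          br_scale_right Kv[OF k])
  qed
  have "br v (br x u) = 0" if x: "x \<in> P" for x u
  proof -
    obtain k p where u: "k \<in> K" "p \<in> P" "u = k + p" by (rule decompose)
    have "br v (br x k) = br (br v x) k + br x (br v k)" by (rule jacobi)
    also have "br (br v x) k = 0"
      using br_anti[of "br v x" k] KKR[OF u(1) PKR[OF x]] by simp
    finally have "br v (br x k) = 0" by (simp add: vK u br_simps)
    moreover have "br v (br x p) = 0" using vK br_PP x u by simp
    ultimately show ?thesis by (simp add: u br_simps)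
  qed
  then have killing_v: "killing v x = 0" if "x \<in> P" for x
    using that by (simp add: killing_def lin_trace_0)

  obtain B where B: "B \<subseteq> P" "independent B" "P \<subseteq> span B" "card B = dim P"
    by (rule basis_exists)
  have finB: "finite B" using finite_if_independent[OF fd B(2)] .
  \<comment> \<open>An element of \<open>P\<close> that is Killing-orthogonal to \<open>P\<close> lies in the radical, hence on the line
      through \<open>v\<close>.\<close>
  have ker: "\<Omega> v x = 0" if x: "x \<in> P" and kx: "\<And>b. b \<in> B \<Longrightarrow> killing b x = 0" for x
  proof -
    have "span B \<subseteq> {b. killing b x = 0}"
      by (rule span_minimal) (use kx subspace_killing in auto)
    then have kP: "killing x p = 0" if "p \<in> P" for p
      using that B(3) by (auto simp: killing_commute[of x])
    have "killing x y = 0" for y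
    proof -
      obtain k p where "k \<in> K" "p \<in> P" "y = k + p" by (rule decompose)
      then show ?thesis using kP killing_K_P[OF _ x] by (simp add: killing_add_right)
    qed
    then have "x \<in> R" by (intro killing_orthogonal_derived_in_radical)
    then obtain a where "x = a *\<^sub>R v" using one x by blast
    then show ?thesis using omega_scale(2)[OF vP vP] omega_self[OF vP] by simp
  qed
  have lin: "linear (killing b)" for b
    by (rule linearI) (simp_all add: killing_add_right killing_scale_right)
  obtain d where d: "\<And>x. x \<in> P \<Longrightarrow> \<Omega> v x = (\<Sum>b\<in>B. d b * killing b x)"
    using functional_combination[where f = "\<Omega> v" and g = killing, OF subspace_P finB
        omega_add(2)[OF _ _ vP] omega_scale(2)[OF vP] lin ker] by blast
  define z where "z = (\<Sum>b\<in>B. d b *\<^sub>R b)"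
  have zP: "z \<in> P"
    unfolding z_def using B(1) by (intro subspace_sum subspace_scale subspace_P) auto
  have lin': "linear (\<lambda>x. killing x y)" for y
    by (rule linearI) (simp_all add: killing_add_left killing_scale_left)
  have z: "\<Omega> v x = killing z x" if "x \<in> P" for x
    using d[OF that] by (simp add: z_def linear_sum[OF lin'] killing_scale_left)
  have "derived_algebra \<subseteq> {y. killing z y = 0}"
  proof (rule bracket_span_subset[OF subspace_killing(2)])
    fix x y :: 'a
    obtain k q where x: "k \<in> K" "q \<in> P" "x = k + q" by (rule decompose)
    obtain k' q' where y: "k' \<in> K" "q' \<in> P" "y = k' + q'" by (rule decompose)
    have "br x y = (br k k' + br q q') + (br k q' + (-1) *\<^sub>R br k' q)"
      using br_anti[of q k'] by (simp add: x y br_simps)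
    moreover have "killing z (br k k') = 0" "killing z (br q q') = 0"
      using killing_K_P[OF _ zP] br_KK br_PP x y by simp_all
    moreover have "killing z (br k q') = 0" "killing z (br k' q) = 0"
      using z[OF br_KP] w_KP x y by simp_all
    ultimately show "br x y \<in> {y. killing z y = 0}"
      by (simp add: killing_add_right killing_scale_right del: scaleR_minus1_left scaleR_minus_left)
  qed
  then have "z \<in> R" by (intro killing_orthogonal_derived_in_radical) blast
  then obtain a where "z = a *\<^sub>R v" using one zP by blast
  then have "\<Omega> v y0 = 0" using z[OF y0(1)] killing_v[OF y0(1)] by (simp add: killing_scale_left)
  then show False using y0(2) by simp
qed

end

section \<open>The bounds on the dimension\<close>

theorem proposition4p1p8:
  fixes br :: "'a::real_vector \<Rightarrow> 'a \<Rightarrow> 'a"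
    and \<sigma> :: "'a \<Rightarrow> 'a"
    and \<Omega> :: "'a \<Rightarrow> 'a \<Rightarrow> real"
  assumes "symplectic_symmetric_triple br \<sigma> \<Omega>"
    and "\<not> lie_solvable br (UNIV :: 'a set)"
    and "\<not> lie_semisimple br"
  shows "2 \<le> dim (P_part \<sigma> \<inter> lie_radical br) \<and>
         dim (P_part \<sigma> \<inter> lie_radical br) + 2 \<le> dim (P_part \<sigma>)"
proof -
  interpret symplectic_triple br \<sigma> \<Omega> using assms(1) by unfold_locales
  obtain C where C: "C \<subseteq> P \<inter> R" "independent C" "P \<inter> R \<subseteq> span C" "card C = dim (P \<inter> R)"
    using basis_exists by blast
  have finC: "finite C" using finite_if_independent[OF fd C(2)] .
  have "2 \<le> dim (P \<inter> R)"
  proof (rule ccontr)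
    assume "\<not> ?thesis"
    then have "card C = 0 \<or> card C = 1" using C(4) by auto
    then consider "C = {}" | v where "C = {v}" using finC by (auto simp: card_1_singleton_iff)
    then show False
    proof cases
      case 1
      then have "P \<inter> R \<subseteq> {0}" using C(3) by simp
      then show False using radical_zero_if_P_radical_zero assms(3) by (simp add: lie_semisimple_def)
    next
      case 2
      have "v \<noteq> 0" using C(2) 2 dependent_zero[of C] by auto
      moreover have "v \<in> P \<inter> R" using C(1) 2 by auto
      moreover have "\<exists>c. x = c *\<^sub>R v" if "x \<in> P \<inter> R" for x
        using C(3) that 2 by (auto simp: span_singleton)
      ultimately show False using P_radical_not_line by blast
    qed
  qed
  moreover have "dim (P \<inter> R) + 2 \<le> dim P"
  proof (rule ccontr)
    assume small: "\<not> ?thesis"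
    obtain D where D: "C \<subseteq> D" "D \<subseteq> P" "independent D" "P \<subseteq> span D"
      using maximal_independent_subset_extend[OF _ C(2), of P] C(1) by blast
    have finD: "finite D" using finite_if_independent[OF fd D(3)] .
    have "card D = dim P" using basis_card_eq_dim[OF D(2,4,3)] .
    then have "card (D - C) \<le> 1" using small C(4) D(1) finC by (simp add: card_Diff_subset)
    then obtain p where p: "D - C \<subseteq> {p}"
      using finD card_le_Suc0_iff_eq[of "D - C"] by (cases "D - C = {}") auto
    have "\<exists>c. x - c *\<^sub>R p \<in> R" if "x \<in> P" for x
    proof -
      have "x \<in> span (insert p C)" using that D(4) p span_mono[of D "insert p C"] by blast
      then obtain c where "x - c *\<^sub>R p \<in> span C" unfolding span_breakdown_eq by blast
      moreover have "span C \<subseteq> R" using C(1) subspace_R by (intro span_minimal) auto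
      ultimately show ?thesis by blast
    qed
    then show False using solvable_if_P_spanned_mod_radical_by_one assms(2) by blast
  qed
  ultimately show ?thesis by blast
qed

end
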